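(* Let $q$ be an odd prime power, $m$ a positive integer and $\varepsilon \in \{+1,-1\}$. The graph $NO_{2m+1}^{\varepsilon}(q)$ satisfies the $4$-vertex condition.
   Context: Let $V$ be a vector space of dimension $2m+1$ over $\mathbb{F}_q$, $q$ odd, and let $Q$ be a nondegenerate quadratic form on $V$. A projective point ($1$-dimensional subspace) $\langle x\rangle$ is singular if $Q(x)=0$ and nonsingular otherwise. A nonsingular point $x$ has type $\varepsilon=+1$ if the hyperplane $x^\perp$ of points orthogonal to $x$ is hyperbolic, and type $\varepsilon=-1$ if $x^\perp$ is elliptic. A projective line is a tangent if it contains exactly one singular point. The graph $NO_{2m+1}^{\varepsilon}(q)$ has as vertex set the set of nonsingular points of type $\varepsilon$, where two distinct points are adjacent when the line joining them is a tangent. A graph $\Gamma$ satisfies the $t$-vertex condition if, for all triples $(T,x_0,y_0)$ consisting of a $t$-vertex graph $T$ together with two distinct distinguished vertices $x_0,y_0$ of $T$, and all pairs of distinct vertices $x,y$ of $\Gamma$, the number of isomorphic copies of $T$ in $\Gamma$ (as induced subgraphs), where the isomorphism maps $x_0$ to $x$ and $y_0$ to $y$, does not depend on the choice of the pair $x,y$ but only on whether $x,y$ are adjacent or nonadjacent. *)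

theory Defs
  imports "Graph_Theory.Graph_Theory" "HOL-Number_Theory.Prime_Powers" "HOL-Library.Cardinality"
begin

section \<open>The t-vertex condition\<close>

text \<open>
  Undirected simple graphs are symmetric loop-free digraphs without parallel arcs; each edge is
  represented by its two orientations.

  A copy is recorded by its vertex set \<open>S\<close>, the subgraph being the induced one. Thus different
  isomorphisms onto the same induced subgraph are counted only once.
\<close>

definition copies ::
    "'a pair_pre_digraph \<Rightarrow> 'a \<Rightarrow> 'a \<Rightarrow> 'b pair_pre_digraph \<Rightarrow> 'b \<Rightarrow> 'b \<Rightarrow> 'b set set" where
  "copies T x0 y0 \<Gamma> x y =
     {S. S \<subseteq> pverts \<Gamma> \<and>
         (\<exists>h. pre_digraph.digraph_isomorphism (with_proj T) h \<and>
              app_iso h (with_proj T) = with_proj \<Gamma> \<restriction> S \<and>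
              iso_verts h x0 = x \<and> iso_verts h y0 = y)}"

text \<open>Since the number of copies depends only on the isomorphism type of \<open>(T, x0, y0)\<close>, it
  suffices to let \<open>T\<close> range over graphs whose vertices are natural numbers.\<close>

definition vertex_condition :: "nat \<Rightarrow> 'b pair_pre_digraph \<Rightarrow> bool" where
  "vertex_condition t \<Gamma> \<longleftrightarrow>
     (\<forall>(T :: nat pair_pre_digraph) x0 y0.
        pair_graph T \<and> card (pverts T) = t \<and> x0 \<in> pverts T \<and> y0 \<in> pverts T \<and> x0 \<noteq> y0 \<longrightarrow>
        (\<forall>x\<in>pverts \<Gamma>. \<forall>y\<in>pverts \<Gamma>. \<forall>x'\<in>pverts \<Gamma>. \<forall>y'\<in>pverts \<Gamma>.
           x \<noteq> y \<and> x' \<noteq> y' \<and> ((x, y) \<in> parcs \<Gamma> \<longleftrightarrow> (x', y') \<in> parcs \<Gamma>) \<longrightarrow>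
           card (copies T x0 y0 \<Gamma> x y) = card (copies T x0 y0 \<Gamma> x' y')))"


section \<open>Quadratic forms\<close>

definition polar :: "('v::ab_group_add \<Rightarrow> 'k::field) \<Rightarrow> 'v \<Rightarrow> 'v \<Rightarrow> 'k" where
  "polar Q u v = Q (u + v) - Q u - Q v"

locale quadratic_space = vector_space scale
  for scale :: "'k::field \<Rightarrow> 'v::ab_group_add \<Rightarrow> 'v" (infixr \<open>*s\<close> 75) +
  fixes Q :: "'v \<Rightarrow> 'k"
  assumes Q_scale: "Q (a *s v) = a\<^sup>2 * Q v"
    and linear_polar: "Vector_Spaces.linear (*s) (*) (polar Q u)"
  \<comment> \<open>linearity in one argument suffices, as \<open>polar Q\<close> is symmetric\<close>
begin

text \<open>The restriction of \<open>Q\<close> to \<open>U\<close> is nondegenerate. This is the notion for odd characteristic,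
  where \<open>Q\<close> and its polar form determine each other.\<close>

definition nondegenerate :: "'v set \<Rightarrow> bool" where
  "nondegenerate U \<longleftrightarrow> (\<forall>u\<in>U. (\<forall>v\<in>U. polar Q u v = 0) \<longrightarrow> u = 0)"

definition perp :: "'v set \<Rightarrow> 'v set" where
  "perp U = {v. \<forall>u\<in>U. polar Q u v = 0}"

definition totally_singular :: "'v set \<Rightarrow> bool" where
  "totally_singular W \<longleftrightarrow> subspace W \<and> (\<forall>w\<in>W. Q w = 0)"

definition witt_index :: "'v set \<Rightarrow> nat" where
  "witt_index U = Max {dim W | W. W \<subseteq> U \<and> totally_singular W}"

text \<open>A nondegenerate space of dimension \<open>2k\<close> over a finite field is hyperbolic if its Witt index
  is \<open>k\<close>, and elliptic if its Witt index is \<open>k - 1\<close>.\<close>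

definition hyperbolic :: "'v set \<Rightarrow> bool" where
  "hyperbolic U \<longleftrightarrow> subspace U \<and> nondegenerate U \<and> dim U = 2 * witt_index U"

definition elliptic :: "'v set \<Rightarrow> bool" where
  "elliptic U \<longleftrightarrow> subspace U \<and> nondegenerate U \<and> dim U = 2 * (witt_index U + 1)"


section \<open>The graph on nonsingular points of a given type\<close>

definition proj_points :: "'v set set" where
  "proj_points = {p. subspace p \<and> dim p = 1}"

definition proj_lines :: "'v set set" where
  "proj_lines = {l. subspace l \<and> dim l = 2}"

definition singular_points :: "'v set set" where
  "singular_points = {p \<in> proj_points. \<forall>v\<in>p. Q v = 0}"

definition nonsingular_points :: "'v set set" where
  "nonsingular_points = proj_points - singular_points"

definition has_type :: "'v set \<Rightarrow> int \<Rightarrow> bool" where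
  "has_type x \<epsilon> \<longleftrightarrow> (\<epsilon> = 1 \<and> hyperbolic (perp x)) \<or> (\<epsilon> = - 1 \<and> elliptic (perp x))"

definition tangent :: "'v set \<Rightarrow> bool" where
  "tangent l \<longleftrightarrow> l \<in> proj_lines \<and> (\<exists>!p. p \<in> singular_points \<and> p \<subseteq> l)"

definition NO_verts :: "int \<Rightarrow> 'v set set" where
  "NO_verts \<epsilon> = {x \<in> nonsingular_points. has_type x \<epsilon>}"

definition NO :: "int \<Rightarrow> 'v set pair_pre_digraph" where
  "NO \<epsilon> = \<lparr> pverts = NO_verts \<epsilon>,
            parcs = {(x, y). x \<in> NO_verts \<epsilon> \<and> y \<in> NO_verts \<epsilon> \<and> x \<noteq> y \<and>
                             tangent (span (x \<union> y))} \<rparr>"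

lemma pair_bidirected_digraph_NO: "pair_bidirected_digraph (NO \<epsilon>)"
  by unfold_locales
    (auto simp: NO_def symmetric_conv arcs_ends_conv Un_commute sym_def intro!: symI)

end

end

theory Submission
  imports Defs
begin

text \<open>
  A graph satisfies the 4-vertex condition as soon as the valency, the number of common neighbours of
  two vertices and the number of edges between these common neighbours depend only on adjacency: the
  edge counts between the remaining classes of vertices then solve a linear system.

  All vertices of type \<open>\<epsilon>\<close> lie in one square class of values of \<open>Q\<close>, because the type is
  the sign of the difference between the numbers of vectors of \<open>x\<^sup>\<bottom>\<close> on which \<open>Q\<close> takes the
  values 0 and 1. So the vertices are the pairs \<open>\<plusminus>v\<close> with \<open>Q v = c\<close>, and \<open>v\<close> and \<open>w\<close> are adjacent
  iff \<open>B v w = \<plusminus>2c\<close>. The isometry group is transitive on edges. For nonadjacent \<open>x, y\<close> a common neighbour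
  with \<open>B x z = B y z = 2c\<close> projects to a vector \<open>u\<close> of \<open>U = {x, y}\<^sup>\<bottom>\<close> of fixed norm, and the
  neighbours of \<open>z\<close> among the common neighbours are counted by the even-dimensional space
  \<open>{x, y, z}\<^sup>\<bottom>\<close>. Such a space represents all nonzero values equally often, and whether the value in
  question is zero turns out not to depend on \<open>B x y\<close>.
\<close>

section \<open>The 4-vertex condition in terms of edge counts\<close>

text \<open>Nonadjacent pairs are the obstacle. Up to sign \<open>B x y\<close> is invariant under
  isometries and may take several values, so no transitivity argument covers these pairs; their
  counts have to be computed and shown to be free of \<open>B x y\<close>. Everything is expressed
  by one integer \<open>E\<close>, the surplus of the value 0 over a nonzero value of
  \<open>Q\<close> on the orthogonal space of a vector of norm \<open>c\<close>. Orthogonal spaces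
  of \<open>x\<close>, of \<open>x, y\<close> and of \<open>x, y, z\<close> have even, odd and even
  dimension. Only in even dimension is the distribution of values simple, so the odd one is
  controlled through its count at 0 and its count in a single square class: minus the norm of the
  vector split off from the first space to get the second lies in the square class of the norm
  \<open>s\<close> of the projected common neighbours. This is why the number of common neighbours
  does not involve \<open>B x y\<close>. With q the order of the field, the surplus on the last
  space is \<open>E\<close> divided by q; identities are multiplied by q or its square so that all
  of them stay in the integers.\<close>

lemma copies_eq:
  assumes "pair_graph T"
  shows "copies T x0 y0 \<Gamma> x y =
    {f ` pverts T | f. inj_on f (pverts T) \<and> f ` pverts T \<subseteq> pverts \<Gamma> \<and> f x0 = x \<and> f y0 = y \<and>
      (\<forall>a\<in>pverts T. \<forall>b\<in>pverts T. (a, b) \<in> parcs T \<longleftrightarrow> (f a, f b) \<in> parcs \<Gamma>)}"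
    (is "_ = ?R")
proof (intro equalityI subsetI)
  interpret T: pair_graph T by fact
  fix S assume "S \<in> copies T x0 y0 \<Gamma> x y"
  then obtain h where S: "S \<subseteq> pverts \<Gamma>"
    and h: "pre_digraph.digraph_isomorphism (with_proj T) h"
    and app: "app_iso h (with_proj T) = with_proj \<Gamma> \<restriction> S"
    and xy: "iso_verts h x0 = x" "iso_verts h y0 = y"
    by (auto simp: copies_def)
  define f where "f = iso_verts h"
  have fS: "f ` pverts T = S"
    using arg_cong[OF app, of verts] by (simp add: f_def)
  \<comment> \<open>Tail and head maps of an induced subgraph are \<open>fst\<close> and
    \<open>snd\<close>, which forces the arc part of \<open>h\<close> to act as \<open>f\<close> on
    both ends. So the vertex map alone decides whether \<open>S\<close> is a copy.\<close>
  have tl: "iso_tail h = fst" "iso_head h = snd"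
    using arg_cong[OF app, of tail] arg_cong[OF app, of head] by simp_all
  have arcs: "iso_arcs h ` parcs T = {e \<in> parcs \<Gamma>. fst e \<in> S \<and> snd e \<in> S}"
    using arg_cong[OF app, of arcs] by simp
  have inj: "inj_on f (pverts T)"
    using h by (simp add: pre_digraph.digraph_isomorphism_def f_def)
  have harc: "iso_arcs h (a, b) = (f a, f b)" if "(a, b) \<in> parcs T" for a b
    using h that tl by (fastforce simp: pre_digraph.digraph_isomorphism_def f_def prod_eq_iff)
  have "(a, b) \<in> parcs T \<longleftrightarrow> (f a, f b) \<in> parcs \<Gamma>" if ab: "a \<in> pverts T" "b \<in> pverts T" for a b
  proof
    assume "(a, b) \<in> parcs T"
    then show "(f a, f b) \<in> parcs \<Gamma>" using arcs harc by (force simp: image_iff)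
  next
    assume "(f a, f b) \<in> parcs \<Gamma>"
    then have "(f a, f b) \<in> iso_arcs h ` parcs T" using arcs fS ab by auto
    then obtain a' b' where e: "(a', b') \<in> parcs T" "(f a, f b) = iso_arcs h (a', b')"
      by (metis (no_types, lifting) imageE surj_pair)
    then have "f a = f a'" "f b = f b'" using harc by auto
    then have "a = a'" "b = b'" using inj ab e T.in_arcsD1 T.in_arcsD2 by (auto dest: inj_onD)
    then show "(a, b) \<in> parcs T" using e by simp
  qed
  then show "S \<in> ?R" using inj fS S xy by (auto simp: f_def intro!: exI[of _ "iso_verts h"])
next
  interpret T: pair_graph T by fact
  fix S assume "S \<in> ?R"
  then obtain f where S: "S = f ` pverts T" and inj: "inj_on f (pverts T)"
    and sub: "f ` pverts T \<subseteq> pverts \<Gamma>" and xy: "f x0 = x" "f y0 = y"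
    and iff: "\<And>a b. a \<in> pverts T \<Longrightarrow> b \<in> pverts T \<Longrightarrow> (a, b) \<in> parcs T \<longleftrightarrow> (f a, f b) \<in> parcs \<Gamma>"
    by auto
  define h where "h = \<lparr>iso_verts = f, iso_arcs = map_prod f f, iso_head = snd, iso_tail = fst\<rparr>"
  have parcsD: "a \<in> pverts T \<and> b \<in> pverts T" if "(a, b) \<in> parcs T" for a b
    using that T.in_arcsD1 T.in_arcsD2 by blast
  have "inj_on (map_prod f f) (parcs T)"
    by (rule inj_on_subset[OF map_prod_inj_on[OF inj inj]]) (use parcsD in auto)
  then have "T.digraph_isomorphism h"
    unfolding T.digraph_isomorphism_def using inj T.wf_digraph by (auto simp: h_def)
  moreover have img: "map_prod f f ` parcs T = {e \<in> parcs \<Gamma>. fst e \<in> S \<and> snd e \<in> S}"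
  proof (intro equalityI subsetI)
    fix e assume "e \<in> map_prod f f ` parcs T"
    then obtain a b where ab: "(a, b) \<in> parcs T" "e = (f a, f b)" by auto
    then show "e \<in> {e \<in> parcs \<Gamma>. fst e \<in> S \<and> snd e \<in> S}"
      using parcsD[OF ab(1)] iff[of a b] by (simp add: S)
  next
    fix e assume e: "e \<in> {e \<in> parcs \<Gamma>. fst e \<in> S \<and> snd e \<in> S}"
    then obtain a b where ab: "a \<in> pverts T" "b \<in> pverts T" "e = (f a, f b)"
      by (auto simp: S prod_eq_iff)
    then have "(a, b) \<in> parcs T" using e iff by simp
    then show "e \<in> map_prod f f ` parcs T" by (rule image_eqI[rotated]) (simp add: ab(3))
  qed
  have "app_iso h (with_proj T) = with_proj \<Gamma> \<restriction> S"
    unfolding app_iso_def induce_subgraph_def h_def with_proj_def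
    by (simp only: digraph_isomorphism.simps pre_digraph.simps img S[symmetric])
  moreover have "iso_verts h x0 = x" "iso_verts h y0 = y" using xy by (simp_all add: h_def)
  ultimately show "S \<in> copies T x0 y0 \<Gamma> x y"
    using S sub unfolding copies_def by blast
qed

lemma card_Un3:
  assumes "finite A" "finite B" "finite C" "A \<inter> B = {}" "A \<inter> C = {}" "B \<inter> C = {}"
  shows "card (A \<union> B \<union> C) = card A + card B + card C"
  using assms by (simp add: card_Un_disjoint Int_Un_distrib2)

section \<open>Edge counts between classes of vertices\<close>

locale simple_graph =
  fixes V :: "'a set" and adj :: "'a \<Rightarrow> 'a \<Rightarrow> bool"
  assumes finite_V: "finite V"
    and adj_sym: "adj x y \<Longrightarrow> adj y x"
    and adj_irrefl: "\<not> adj x x"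
    and adj_V: "adj x y \<Longrightarrow> x \<in> V \<and> y \<in> V"
begin

definition nbrs :: "'a \<Rightarrow> 'a set" where
  "nbrs x = {z. adj x z}"

definition edges :: "'a set \<Rightarrow> 'a set \<Rightarrow> nat" where
  "edges A B = card {(z, w) \<in> A \<times> B. adj z w}"

definition cls :: "'a \<Rightarrow> 'a \<Rightarrow> bool \<Rightarrow> bool \<Rightarrow> 'a set" where
  "cls x y i j = {z \<in> V - {x, y}. adj x z = i \<and> adj y z = j}"

text \<open>Ordered candidates for the two undistinguished vertices of a four-vertex graph:
  \<open>i, j\<close> and \<open>k, l\<close> prescribe their adjacencies to \<open>x, y\<close>,
  and \<open>e\<close> their mutual adjacency.\<close>

definition pattern :: "'a \<Rightarrow> 'a \<Rightarrow> bool \<Rightarrow> bool \<Rightarrow> bool \<Rightarrow> bool \<Rightarrow> bool \<Rightarrow> ('a \<times> 'a) set" where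
  "pattern x y i j k l e = {(z, w) \<in> cls x y i j \<times> cls x y k l. z \<noteq> w \<and> adj z w = e}"

lemma finite_cls: "finite (cls x y i j)"
  using finite_V by (auto simp: cls_def)

lemma finite_nbrs: "finite (nbrs x)"
  using finite_V adj_V by (auto simp: nbrs_def intro: finite_subset)

lemma nbrs_subset: "nbrs x \<subseteq> V"
  using adj_V by (auto simp: nbrs_def)

lemma edges_commute: "edges A B = edges B A"
  unfolding edges_def
  by (rule bij_betw_same_card[of prod.swap])
    (auto simp: bij_betw_def inj_on_def image_iff adj_sym)

lemma edges_eq_sum:
  assumes "finite A" "finite B"
  shows "edges A B = (\<Sum>z\<in>A. card (nbrs z \<inter> B))"
proof -
  have "{(z, w) \<in> A \<times> B. adj z w} = (SIGMA z:A. nbrs z \<inter> B)"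
    by (auto simp: nbrs_def)
  then show ?thesis using assms by (simp add: edges_def finite_nbrs)
qed

text \<open>For nonadjacent pairs, edges and the diagonal are removed from the product; the diagonal
  occurs only if both classes coincide. The additive form avoids truncated subtraction.\<close>

lemma card_pattern:
  "card (pattern x y i j k l e) + (if e then 0 else edges (cls x y i j) (cls x y k l) +
     (if (i, j) = (k, l) then card (cls x y i j) else 0)) =
   (if e then edges (cls x y i j) (cls x y k l) else card (cls x y i j) * card (cls x y k l))"
proof (cases e)
  case True
  then have "pattern x y i j k l e = {(z, w) \<in> cls x y i j \<times> cls x y k l. adj z w}"
    by (auto simp: pattern_def adj_irrefl)
  then show ?thesis using True by (simp add: edges_def)
next
  case False
  let ?A = "cls x y i j" and ?B = "cls x y k l"
  let ?E = "{(z, w) \<in> ?A \<times> ?B. adj z w}" and ?D = "{(z, w) \<in> ?A \<times> ?B. z = w}"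
  have fin: "finite (?A \<times> ?B)" using finite_cls by auto
  have split: "?A \<times> ?B = pattern x y i j k l e \<union> (?E \<union> ?D)"
    using False by (auto simp: pattern_def)
  have disj: "pattern x y i j k l e \<inter> (?E \<union> ?D) = {}" "?E \<inter> ?D = {}"
    using False by (auto simp: pattern_def adj_irrefl)
  have D: "card ?D = (if (i, j) = (k, l) then card ?A else 0)"
  proof (cases "(i, j) = (k, l)")
    case True
    then have "?D = (\<lambda>z. (z, z)) ` ?A" by auto
    then show ?thesis using True by (simp add: card_image inj_on_def)
  next
    case neq: False
    then have "?D = {}" by (auto simp: cls_def)
    then have "card ?D = 0" by (simp only: card.empty)
    then show ?thesis unfolding if_not_P[OF neq] .
  qed
  have fins: "finite (pattern x y i j k l e)" "finite ?E" "finite ?D"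
    by (rule finite_subset[OF _ fin]; force simp: pattern_def)+
  have "card (?A \<times> ?B) = card (pattern x y i j k l e \<union> (?E \<union> ?D))"
    using split by (rule arg_cong[of _ _ card])
  also have "\<dots> = card (pattern x y i j k l e) + card (?E \<union> ?D)"
    by (rule card_Un_disjoint[OF fins(1) finite_UnI[OF fins(2,3)] disj(1)])
  also have "card (?E \<union> ?D) = card ?E + card ?D"
    by (rule card_Un_disjoint[OF fins(2,3) disj(2)])
  finally show ?thesis
    unfolding D edges_def card_cartesian_product if_not_P[OF False] by (simp only: add.assoc)
qed

text \<open>Since \<open>z\<close> and \<open>w\<close> avoid \<open>x\<close> and \<open>y\<close>,
  the set \<open>{x, y, z, w}\<close> determines \<open>{z, w}\<close>. Within one class both orders
  of the pair occur; for different classes the class of a vertex tells which entry it is.\<close>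

lemma card_pattern_unordered:
  "card ((\<lambda>(z, w). {x, y, z, w}) ` pattern x y i j k l e) * (if (i, j) = (k, l) then 2 else 1) =
   card (pattern x y i j k l e)"
proof -
  let ?P = "pattern x y i j k l e" and ?f = "\<lambda>(z, w). {x, y, z, w}"
  have fin: "finite ?P"
    by (rule finite_subset[of _ "V \<times> V"]) (use finite_V in \<open>auto simp: pattern_def cls_def\<close>)
  have fib: "{z, w} = {z', w'}" if "(z, w) \<in> ?P" "(z', w') \<in> ?P" "?f (z, w) = ?f (z', w')"
    for z w z' w'
    using that unfolding pattern_def cls_def by auto
  show ?thesis
  proof (cases "(i, j) = (k, l)")
    case True
    have "card ?P = (\<Sum>S\<in>?f ` ?P. card {p \<in> ?P. ?f p = S})"
      using sum.image_gen[OF fin, of "\<lambda>_. 1::nat" ?f] by simp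
    also have "\<dots> = (\<Sum>S\<in>?f ` ?P. 2)"
    proof (rule sum.cong[OF refl])
      fix S assume "S \<in> ?f ` ?P"
      then obtain z w where zw: "(z, w) \<in> ?P" "S = ?f (z, w)" by auto
      have wz: "(w, z) \<in> ?P" using zw True by (auto simp: pattern_def adj_sym)
      have "{p \<in> ?P. ?f p = S} = {(z, w), (w, z)}"
        using zw wz fib by (fastforce simp: doubleton_eq_iff)
      moreover have "z \<noteq> w" using zw by (auto simp: pattern_def)
      ultimately show "card {p \<in> ?P. ?f p = S} = 2" by simp
    qed
    finally show ?thesis using True by simp
  next
    case False
    have "inj_on ?f ?P"
    proof (rule inj_onI)
      fix p p' assume p: "p \<in> ?P" "p' \<in> ?P" "?f p = ?f p'"
      obtain z w z' w' where zw: "p = (z, w)" "p' = (z', w')" by (cases p, cases p')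
      have "{z, w} = {z', w'}" using p fib[of z w z' w'] unfolding zw by simp
      then have "z = z' \<and> w = w' \<or> z = w' \<and> w = z'" by (simp add: doubleton_eq_iff)
      moreover have "\<not> (z = w' \<and> w = z')"
        using p(1,2) zw False by (auto simp: pattern_def cls_def)
      ultimately show "p = p'" using zw by simp
    qed
    then show ?thesis unfolding if_not_P[OF False] by (simp add: card_image)
  qed
qed

lemma edges_add:
  assumes "finite A" "\<And>z. z \<in> A \<Longrightarrow> card (nbrs z \<inter> B) + card (nbrs z \<inter> C) + d = r" "finite B" "finite C"
  shows "edges A B + edges A C + card A * d = card A * r"
proof -
  have "edges A B + edges A C + card A * d = (\<Sum>z\<in>A. card (nbrs z \<inter> B) + card (nbrs z \<inter> C) + d)"
    using assms(1,3,4) by (simp add: edges_eq_sum sum.distrib)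
  also have "\<dots> = (\<Sum>z\<in>A. r)" using assms(2) by (intro sum.cong) auto
  finally show ?thesis by simp
qed

text \<open>The common neighbours of \<open>z\<close> and \<open>x\<close> lie in two classes,
  except that \<open>y\<close> is one of them when it is adjacent to both and belongs to no class.
  The second equation exchanges \<open>x\<close> and \<open>y\<close>.\<close>

lemma card_nbrs_cls:
  assumes "x \<in> V" "y \<in> V" "x \<noteq> y"
    and lam: "\<And>u v. u \<in> V \<Longrightarrow> v \<in> V \<Longrightarrow> u \<noteq> v \<Longrightarrow> card (nbrs u \<inter> nbrs v) = lam (adj u v)"
    and z: "z \<in> cls x y i j"
  shows "card (nbrs z \<inter> cls x y True True) + card (nbrs z \<inter> cls x y True False) +
      of_bool (adj x y \<and> j) = lam i"
    and "card (nbrs z \<inter> cls x y True True) + card (nbrs z \<inter> cls x y False True) +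
      of_bool (adj x y \<and> i) = lam j"
proof -
  have zV: "z \<in> V" "z \<noteq> x" "z \<noteq> y" "adj x z = i" "adj y z = j" using z by (auto simp: cls_def)
  have *: "card (nbrs z \<inter> nbrs x) = lam i" "card (nbrs z \<inter> nbrs y) = lam j"
    using lam[of z x] lam[of z y] zV assms(1,2) adj_sym[of z x] adj_sym[of x z]
      adj_sym[of z y] adj_sym[of y z] by (auto, (metis (full_types))+)
  have "nbrs z \<inter> nbrs x = (nbrs z \<inter> cls x y True True) \<union> (nbrs z \<inter> cls x y True False) \<union>
      (if adj x y \<and> j then {y} else {})" (is "_ = ?A \<union> ?B \<union> ?C")
    using zV adj_V adj_irrefl adj_sym by (auto simp: nbrs_def cls_def split: if_splits)
  moreover have "card (?A \<union> ?B \<union> ?C) = card ?A + card ?B + card ?C"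
    by (rule card_Un3) (use finite_nbrs[of z] in \<open>auto simp: cls_def\<close>)
  ultimately show "card (nbrs z \<inter> cls x y True True) + card (nbrs z \<inter> cls x y True False) +
      of_bool (adj x y \<and> j) = lam i"
    using * by (cases "adj x y \<and> j") auto
  have "nbrs z \<inter> nbrs y = (nbrs z \<inter> cls x y True True) \<union> (nbrs z \<inter> cls x y False True) \<union>
      (if adj x y \<and> i then {x} else {})" (is "_ = ?A \<union> ?B \<union> ?C")
    using zV adj_V adj_irrefl adj_sym by (auto simp: nbrs_def cls_def split: if_splits)
  moreover have "card (?A \<union> ?B \<union> ?C) = card ?A + card ?B + card ?C"
    by (rule card_Un3) (use finite_nbrs[of z] in \<open>auto simp: cls_def\<close>)
  ultimately show "card (nbrs z \<inter> cls x y True True) + card (nbrs z \<inter> cls x y False True) +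
      of_bool (adj x y \<and> i) = lam j"
    using * by (cases "adj x y \<and> i") auto
qed

lemma card_nbrs_cls_all:
  assumes "x \<in> V" "y \<in> V" "x \<noteq> y"
    and z: "adj x z = i" "adj y z = j"
  shows "card (nbrs z \<inter> (cls x y True True \<union> cls x y True False)) +
     card (nbrs z \<inter> (cls x y False True \<union> cls x y False False)) + (of_bool i + of_bool j) = card (nbrs z)"
proof -
  let ?A = "nbrs z \<inter> (cls x y True True \<union> cls x y True False)"
  let ?B = "nbrs z \<inter> (cls x y False True \<union> cls x y False False)"
  let ?C = "(if i then {x} else {}) \<union> (if j then {y} else {})"
  have "w \<in> nbrs z \<longleftrightarrow> w \<in> ?A \<union> ?B \<union> ?C" for w
    using z adj_V[of z w] adj_sym[of z x] adj_sym[of x z] adj_sym[of z y] adj_sym[of y z] assms(3)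
    by (cases "w = x"; cases "w = y"; cases "adj x w"; cases "adj y w") (auto simp: nbrs_def cls_def)
  then have "nbrs z = ?A \<union> ?B \<union> ?C" by blast
  then have "card (nbrs z) = card (?A \<union> ?B \<union> ?C)" by (rule arg_cong[of _ _ card])
  also have "\<dots> = card ?A + card ?B + card ?C"
    by (rule card_Un3) (use finite_nbrs[of z] in \<open>auto simp: cls_def\<close>)
  also have "card ?C = of_bool i + of_bool j" using assms(3) by simp
  finally show ?thesis by simp
qed

lemma edges_Un:
  assumes "finite A" "finite B" "finite C" "B \<inter> C = {}"
  shows "edges A (B \<union> C) = edges A B + edges A C"
proof -
  have "card (nbrs z \<inter> (B \<union> C)) = card (nbrs z \<inter> B) + card (nbrs z \<inter> C)" for z
    unfolding Int_Un_distrib by (rule card_Un_disjoint) (use assms finite_nbrs in auto)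
  then show ?thesis using assms by (simp add: edges_eq_sum sum.distrib)
qed

lemma automorphism_counts:
  assumes bij: "bij_betw f V V" and adj: "\<And>x y. x \<in> V \<Longrightarrow> y \<in> V \<Longrightarrow> adj (f x) (f y) \<longleftrightarrow> adj x y"
    and xy: "x \<in> V" "y \<in> V"
  shows "card (nbrs (f x)) = card (nbrs x)"
    "card (nbrs (f x) \<inter> nbrs (f y)) = card (nbrs x \<inter> nbrs y)"
    "edges (nbrs (f x) \<inter> nbrs (f y)) (nbrs (f x) \<inter> nbrs (f y)) = edges (nbrs x \<inter> nbrs y) (nbrs x \<inter> nbrs y)"
proof -
  have inj: "inj_on f V" and im: "f ` V = V" using bij by (auto simp: bij_betw_def)
  have injA: "inj_on f A" if "A \<subseteq> V" for A using inj that by (rule inj_on_subset)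
  have nb: "nbrs (f x) = f ` nbrs x" if x: "x \<in> V" for x
  proof (intro equalityI subsetI)
    fix w assume "w \<in> nbrs (f x)"
    then have "adj (f x) w" "w \<in> V" using adj_V by (auto simp: nbrs_def)
    then obtain z where "z \<in> V" "w = f z" using im by blast
    then show "w \<in> f ` nbrs x" using \<open>adj (f x) w\<close> adj x by (auto simp: nbrs_def)
  next
    fix w assume "w \<in> f ` nbrs x"
    then show "w \<in> nbrs (f x)" using adj x adj_V by (auto simp: nbrs_def)
  qed
  have common: "nbrs (f x) \<inter> nbrs (f y) = f ` (nbrs x \<inter> nbrs y)"
    unfolding nb[OF xy(1)] nb[OF xy(2)] by (rule inj_on_image_Int[OF inj nbrs_subset nbrs_subset, symmetric])
  show "card (nbrs (f x)) = card (nbrs x)"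
    unfolding nb[OF xy(1)] by (rule card_image[OF injA[OF nbrs_subset]])
  let ?C = "nbrs x \<inter> nbrs y"
  have C: "?C \<subseteq> V" using nbrs_subset by auto
  show "card (nbrs (f x) \<inter> nbrs (f y)) = card ?C"
    unfolding common by (rule card_image[OF injA[OF C]])
  have "bij_betw (map_prod f f) {(z, w) \<in> ?C \<times> ?C. adj z w} {(z, w) \<in> f ` ?C \<times> f ` ?C. adj z w}"
    unfolding bij_betw_def
  proof
    show "inj_on (map_prod f f) {(z, w) \<in> ?C \<times> ?C. adj z w}"
      by (rule inj_on_subset[OF map_prod_inj_on[OF injA[OF C] injA[OF C]]]) auto
    show "map_prod f f ` {(z, w) \<in> ?C \<times> ?C. adj z w} = {(z, w) \<in> f ` ?C \<times> f ` ?C. adj z w}"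
    proof (intro equalityI subsetI)
      fix p assume "p \<in> map_prod f f ` {(z, w) \<in> ?C \<times> ?C. adj z w}"
      then obtain z w where "p = (f z, f w)" "z \<in> ?C" "w \<in> ?C" "adj z w" by auto
      then show "p \<in> {(z, w) \<in> f ` ?C \<times> f ` ?C. adj z w}" using adj[of z w] C by blast
    next
      fix p assume "p \<in> {(z, w) \<in> f ` ?C \<times> f ` ?C. adj z w}"
      then obtain z w where zw: "p = (f z, f w)" "z \<in> ?C" "w \<in> ?C" "adj (f z) (f w)" by blast
      then have "adj z w" using adj[of z w] C by blast
      then show "p \<in> map_prod f f ` {(z, w) \<in> ?C \<times> ?C. adj z w}" using zw by (intro image_eqI[of _ _ "(z, w)"]) auto
    qed
  qed
  then show "edges (nbrs (f x) \<inter> nbrs (f y)) (nbrs (f x) \<inter> nbrs (f y)) = edges ?C ?C"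
    unfolding common edges_def by (rule bij_betw_same_card[symmetric])
qed

end

text \<open>A quantity that is constant on the fibres of \<open>a\<close> factors through
  \<open>a\<close>. This later supplies \<open>lam\<close> and \<open>ed\<close> as functions of
  adjacency.\<close>

lemma ex_function_of_value:
  assumes "\<And>p p'. p \<in> S \<Longrightarrow> p' \<in> S \<Longrightarrow> a p = a p' \<Longrightarrow> f p = f p'"
  obtains g where "\<And>p. p \<in> S \<Longrightarrow> f p = g (a p)"
proof
  fix p assume p: "p \<in> S"
  then have "(SOME p'. p' \<in> S \<and> a p' = a p) \<in> S \<and> a (SOME p'. p' \<in> S \<and> a p' = a p) = a p"
    by (intro someI[of "\<lambda>p'. p' \<in> S \<and> a p' = a p"]) simp
  then show "f p = (\<lambda>r. f (SOME p'. p' \<in> S \<and> a p' = r)) (a p)" using assms[OF p] by simp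
qed

locale constant_counts_graph = simple_graph +
  fixes k :: nat and lam ed :: "bool \<Rightarrow> nat"
  assumes card_nbrs: "x \<in> V \<Longrightarrow> card (nbrs x) = k"
    and card_common: "x \<in> V \<Longrightarrow> y \<in> V \<Longrightarrow> x \<noteq> y \<Longrightarrow> card (nbrs x \<inter> nbrs y) = lam (adj x y)"
    and edges_common: "x \<in> V \<Longrightarrow> y \<in> V \<Longrightarrow> x \<noteq> y \<Longrightarrow>
      edges (nbrs x \<inter> nbrs y) (nbrs x \<inter> nbrs y) = ed (adj x y)"
begin

text \<open>Edges leaving one class are counted through common neighbours with \<open>x\<close>,
  through common neighbours with \<open>y\<close>, and through the valency. The
  \<open>of_bool\<close> terms account for \<open>x\<close> and \<open>y\<close>, which lie in no
  class.\<close>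

lemma class_equations:
  assumes "x \<in> V" "y \<in> V" "x \<noteq> y"
  defines "e \<equiv> \<lambda>i j k l. edges (cls x y i j) (cls x y k l)" and "c \<equiv> \<lambda>i j. card (cls x y i j)"
  shows "e i j True True + e i j True False + c i j * of_bool (adj x y \<and> j) = c i j * lam i"
    and "e i j True True + e i j False True + c i j * of_bool (adj x y \<and> i) = c i j * lam j"
    and "e i j True True + e i j True False + (e i j False True + e i j False False) +
      c i j * (of_bool i + of_bool j) = c i j * k"
    and "e True True True True = ed (adj x y)"
    and "c True True = lam (adj x y)"
    and "c True True + c True False + of_bool (adj x y) = k"
    and "c True True + c False True + of_bool (adj x y) = k"
    and "c True True + c True False + c False True + c False False + 2 = card V"
proof -
  have C11: "cls x y True True = nbrs x \<inter> nbrs y"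
    using adj_V adj_irrefl by (auto simp: cls_def nbrs_def)
  show "e i j True True + e i j True False + c i j * of_bool (adj x y \<and> j) = c i j * lam i"
    "e i j True True + e i j False True + c i j * of_bool (adj x y \<and> i) = c i j * lam j"
    unfolding e_def c_def
    using card_nbrs_cls[OF assms(1-3) card_common] by (intro edges_add finite_cls; blast)+
  have "edges (cls x y i j) (cls x y True True \<union> cls x y True False) +
      edges (cls x y i j) (cls x y False True \<union> cls x y False False) +
      card (cls x y i j) * (of_bool i + of_bool j) = card (cls x y i j) * k"
  proof (intro edges_add finite_cls finite_UnI)
    fix z assume "z \<in> cls x y i j"
    then have "z \<in> V" "adj x z = i" "adj y z = j" by (auto simp: cls_def)
    then show "card (nbrs z \<inter> (cls x y True True \<union> cls x y True False)) +
     card (nbrs z \<inter> (cls x y False True \<union> cls x y False False)) + (of_bool i + of_bool j) = k"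
      using card_nbrs_cls_all[OF assms(1-3)] card_nbrs by metis
  qed
  moreover have "cls x y a b \<inter> cls x y a' b' = {}" if "(a, b) \<noteq> (a', b')" for a b a' b'
    using that by (auto simp: cls_def)
  ultimately show "e i j True True + e i j True False + (e i j False True + e i j False False) +
      c i j * (of_bool i + of_bool j) = c i j * k"
    unfolding e_def c_def by (simp add: edges_Un finite_cls)
  show "e True True True True = ed (adj x y)" "c True True = lam (adj x y)"
    unfolding e_def c_def C11 using card_common edges_common assms by auto
  have fin: "finite (cls x y a b)" for a b by (rule finite_cls)
  have "nbrs x = cls x y True True \<union> cls x y True False \<union> (if adj x y then {y} else {})"
    (is "_ = ?A \<union> ?B \<union> ?C")
    using adj_V adj_irrefl by (auto simp: nbrs_def cls_def)
  moreover have "card (?A \<union> ?B \<union> ?C) = card ?A + card ?B + card ?C"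
    by (rule card_Un3; (intro finite_UnI finite_cls)?; force simp: cls_def)
  ultimately show "c True True + c True False + of_bool (adj x y) = k"
    using card_nbrs[OF assms(1)] by (cases "adj x y") (auto simp: c_def)
  have "nbrs y = cls x y True True \<union> cls x y False True \<union> (if adj x y then {x} else {})"
    (is "_ = ?A \<union> ?B \<union> ?C")
    using adj_V adj_irrefl adj_sym by (auto simp: nbrs_def cls_def)
  moreover have "card (?A \<union> ?B \<union> ?C) = card ?A + card ?B + card ?C"
    by (rule card_Un3; (intro finite_UnI finite_cls)?; force simp: cls_def)
  ultimately show "c True True + c False True + of_bool (adj x y) = k"
    using card_nbrs[OF assms(2)] by (cases "adj x y") (auto simp: c_def)
  have "V = (cls x y True True \<union> cls x y True False \<union> cls x y False True) \<union> cls x y False False \<union> {x, y}"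
    (is "_ = ?A \<union> ?D \<union> ?E")
    using assms(1,2) by (auto simp: cls_def)
  then have "card V = card (?A \<union> ?D \<union> ?E)" by (rule arg_cong[of _ _ card])
  also have "\<dots> = card ?A + card ?D + card ?E"
    by (rule card_Un3; (intro finite_UnI finite_cls)?; force simp: cls_def)
  also have "card ?A = card (cls x y True True) + card (cls x y True False) + card (cls x y False True)"
    by (rule card_Un3; (intro finite_UnI finite_cls)?; force simp: cls_def)
  also have "card {x, y} = 2" using assms(3) by simp
  finally show "c True True + c True False + c False True + c False False + 2 = card V"
    by (simp add: c_def)
qed

text \<open>For a fixed first class, the three equations determine its edge counts to all classes
  from its edge count to the class of common neighbours. For the common neighbours themselves that
  count is \<open>ed\<close>; by symmetry this yields the missing count for every other class, and
  the equations apply again.\<close>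

lemma class_numbers_eq:
  assumes "x \<in> V" "y \<in> V" "x \<noteq> y" "x' \<in> V" "y' \<in> V" "x' \<noteq> y'" "adj x y = adj x' y'"
  shows "card (cls x y i j) = card (cls x' y' i j)"
    and "edges (cls x y i j) (cls x y k' l) = edges (cls x' y' i j) (cls x' y' k' l)"
proof -
  note E = class_equations[OF assms(1-3)] and E' = class_equations[OF assms(4-6), folded assms(7)]
  have c: "card (cls x y i j) = card (cls x' y' i j)" for i j
  proof -
    have 11: "card (cls x y True True) = card (cls x' y' True True)" using E(5) E'(5) by (rule trans[OF _ sym])
    have 10: "card (cls x y True False) = card (cls x' y' True False)"
      and 01: "card (cls x y False True) = card (cls x' y' False True)" using 11 E(6,7) E'(6,7) by linarith+
    have "card (cls x y False False) = card (cls x' y' False False)" using 11 10 01 E(8) E'(8) by linarith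
    then show ?thesis using 11 10 01 by (cases i; cases j) simp_all
  qed
  have *: "edges (cls x y a b) (cls x y True False) = edges (cls x' y' a b) (cls x' y' True False)"
    "edges (cls x y a b) (cls x y False True) = edges (cls x' y' a b) (cls x' y' False True)"
    "edges (cls x y a b) (cls x y False False) = edges (cls x' y' a b) (cls x' y' False False)"
    if "edges (cls x y a b) (cls x y True True) = edges (cls x' y' a b) (cls x' y' True True)" for a b
    using E(1-3)[of a b] E'(1-3)[of a b] that unfolding c[of a b] by linarith+
  have 1: "edges (cls x y True True) (cls x y True True) = edges (cls x' y' True True) (cls x' y' True True)"
    using E(4) E'(4) by simp
  have 2: "edges (cls x y a b) (cls x y True True) = edges (cls x' y' a b) (cls x' y' True True)" for a b
  proof -
    have "edges (cls x y True True) (cls x y a b) = edges (cls x' y' True True) (cls x' y' a b)"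
      using *[OF 1] 1 by (cases a; cases b) simp_all
    then show ?thesis by (simp only: edges_commute[of "cls x y a b"] edges_commute[of "cls x' y' a b"])
  qed
  show "card (cls x y i j) = card (cls x' y' i j)" by (rule c)
  show "edges (cls x y i j) (cls x y k' l) = edges (cls x' y' i j) (cls x' y' k' l)"
    using *[OF 2[of i j]] 2[of i j] by (cases k'; cases l) simp_all
qed

lemma card_copy_sets_eq:
  assumes "x \<in> V" "y \<in> V" "x \<noteq> y" "x' \<in> V" "y' \<in> V" "x' \<noteq> y'" "adj x y = adj x' y'"
  shows "card ((\<lambda>(z, w). {x, y, z, w}) ` pattern x y i j k' l e) =
    card ((\<lambda>(z, w). {x', y', z, w}) ` pattern x' y' i j k' l e)"
proof -
  have "card (pattern x y i j k' l e) = card (pattern x' y' i j k' l e)"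
    using card_pattern[of x y i j k' l e] card_pattern[of x' y' i j k' l e]
    unfolding class_numbers_eq[OF assms] by linarith
  note pattern = this
  define m where "m = (if (i, j) = (k', l) then 2 else 1 :: nat)"
  have "card ((\<lambda>(z, w). {x, y, z, w}) ` pattern x y i j k' l e) * m =
    card ((\<lambda>(z, w). {x', y', z, w}) ` pattern x' y' i j k' l e) * m"
    unfolding m_def card_pattern_unordered by (rule pattern)
  moreover have "m \<noteq> 0" by (simp add: m_def)
  ultimately show ?thesis by simp
qed

end

text \<open>If \<open>x0, y0\<close> and \<open>x, y\<close> agree in adjacency, the copies of
  \<open>T\<close> are the vertex sets given by one pattern, read off from the adjacencies of the
  two other vertices of \<open>T\<close>; otherwise there are no copies.\<close>

theorem vertex_condition_4:
  assumes "constant_counts_graph (pverts \<Gamma>) (\<lambda>x y. (x, y) \<in> parcs \<Gamma>) k lam ed"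
  shows "vertex_condition 4 \<Gamma>"
  unfolding vertex_condition_def
proof (intro allI impI ballI)
  interpret constant_counts_graph "pverts \<Gamma>" "\<lambda>x y. (x, y) \<in> parcs \<Gamma>" k lam ed by fact
  fix T :: "nat pair_pre_digraph" and x0 y0 x y x' y'
  assume T: "pair_graph T \<and> card (pverts T) = 4 \<and> x0 \<in> pverts T \<and> y0 \<in> pverts T \<and> x0 \<noteq> y0"
    and V: "x \<in> pverts \<Gamma>" "y \<in> pverts \<Gamma>" "x' \<in> pverts \<Gamma>" "y' \<in> pverts \<Gamma>"
    and xy: "x \<noteq> y \<and> x' \<noteq> y' \<and> ((x, y) \<in> parcs \<Gamma> \<longleftrightarrow> (x', y') \<in> parcs \<Gamma>)"
  interpret T: pair_graph T using T by simp
  have "card (pverts T - {x0, y0}) = 2" using T by (simp add: card_Diff_subset)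
  then obtain a b where ab: "pverts T - {x0, y0} = {a, b}" "a \<noteq> b" by (auto simp: card_2_iff)
  then have PT: "pverts T = {x0, y0, a, b}" and ne: "x0 \<noteq> a" "x0 \<noteq> b" "y0 \<noteq> a" "y0 \<noteq> b" "x0 \<noteq> y0"
    using T by auto
  have symT: "(u, v) \<in> parcs T \<longleftrightarrow> (v, u) \<in> parcs T" for u v
    using T.arcs_symmetric by blast
  have irrT: "(u, u) \<notin> parcs T" for u using T.no_loops' by blast
  let ?i = "(x0, a) \<in> parcs T" and ?j = "(y0, a) \<in> parcs T" and ?k = "(x0, b) \<in> parcs T"
    and ?l = "(y0, b) \<in> parcs T" and ?e = "(a, b) \<in> parcs T"
  have cop: "copies T x0 y0 \<Gamma> x y = (if (x0, y0) \<in> parcs T \<longleftrightarrow> (x, y) \<in> parcs \<Gamma>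
      then (\<lambda>(z, w). {x, y, z, w}) ` pattern x y ?i ?j ?k ?l ?e else {})"
    if xyV: "x \<in> pverts \<Gamma>" "y \<in> pverts \<Gamma>" "x \<noteq> y" for x y
  proof (intro equalityI subsetI)
    fix S assume "S \<in> copies T x0 y0 \<Gamma> x y"
    then obtain f where f: "S = f ` pverts T" "inj_on f (pverts T)" "f ` pverts T \<subseteq> pverts \<Gamma>"
        "f x0 = x" "f y0 = y"
      and iff: "\<And>u v. u \<in> pverts T \<Longrightarrow> v \<in> pverts T \<Longrightarrow> (u, v) \<in> parcs T \<longleftrightarrow> (f u, f v) \<in> parcs \<Gamma>"
      unfolding copies_eq[OF T.pair_graph] by blast
    have "f a \<noteq> f b" "f a \<noteq> x" "f b \<noteq> x" "f a \<noteq> y" "f b \<noteq> y"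
      using f(2) ab(2) ne unfolding f(4,5)[symmetric] PT by (auto dest: inj_onD)
    then have "(f a, f b) \<in> pattern x y ?i ?j ?k ?l ?e"
      using f(3-5) iff[of x0 a] iff[of y0 a] iff[of x0 b] iff[of y0 b] iff[of a b]
      unfolding pattern_def cls_def PT by auto
    moreover have "S = {x, y, f a, f b}" using f PT by auto
    moreover have "(x0, y0) \<in> parcs T \<longleftrightarrow> (x, y) \<in> parcs \<Gamma>" using iff[of x0 y0] f PT by simp
    ultimately show "S \<in> (if (x0, y0) \<in> parcs T \<longleftrightarrow> (x, y) \<in> parcs \<Gamma>
      then (\<lambda>(z, w). {x, y, z, w}) ` pattern x y ?i ?j ?k ?l ?e else {})" by (auto intro: rev_image_eqI)
  next
    fix S assume "S \<in> (if (x0, y0) \<in> parcs T \<longleftrightarrow> (x, y) \<in> parcs \<Gamma>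
      then (\<lambda>(z, w). {x, y, z, w}) ` pattern x y ?i ?j ?k ?l ?e else {})"
    then have xy0: "(x0, y0) \<in> parcs T \<longleftrightarrow> (x, y) \<in> parcs \<Gamma>"
      and "S \<in> (\<lambda>(z, w). {x, y, z, w}) ` pattern x y ?i ?j ?k ?l ?e"
      by (simp_all split: if_splits)
    then obtain z w where S: "S = {x, y, z, w}" and zw: "(z, w) \<in> pattern x y ?i ?j ?k ?l ?e" by auto
    have zw': "z \<in> pverts \<Gamma>" "w \<in> pverts \<Gamma>" "z \<noteq> x" "z \<noteq> y" "w \<noteq> x" "w \<noteq> y" "z \<noteq> w"
        "?i \<longleftrightarrow> (x, z) \<in> parcs \<Gamma>" "?j \<longleftrightarrow> (y, z) \<in> parcs \<Gamma>" "?k \<longleftrightarrow> (x, w) \<in> parcs \<Gamma>"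
        "?l \<longleftrightarrow> (y, w) \<in> parcs \<Gamma>" "?e \<longleftrightarrow> (z, w) \<in> parcs \<Gamma>"
      using zw by (auto simp: pattern_def cls_def)
    define f where "f = (\<lambda>u. if u = x0 then x else if u = y0 then y else if u = a then z else w)"
    have f: "f x0 = x" "f y0 = y" "f a = z" "f b = w" using ne ab(2) by (auto simp: f_def)
    have "\<forall>u\<in>pverts T. \<forall>v\<in>pverts T. (u, v) \<in> parcs T \<longleftrightarrow> (f u, f v) \<in> parcs \<Gamma>"
      unfolding PT ball_simps f
      using zw'(8-12) xy0 irrT adj_irrefl symT[of y0 x0] symT[of a x0] symT[of a y0] symT[of b x0]
        symT[of b y0] symT[of b a] adj_sym by metis
    moreover have "inj_on f (pverts T)"
      unfolding PT inj_on_def ball_simps f using zw'(3-7) xyV(3) by auto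
    moreover have "S = f ` pverts T" "f ` pverts T \<subseteq> pverts \<Gamma>"
      using S PT f zw'(1,2) xyV by auto
    ultimately show "S \<in> copies T x0 y0 \<Gamma> x y"
      unfolding copies_eq[OF T.pair_graph] using f(1,2) by blast
  qed
  show "card (copies T x0 y0 \<Gamma> x y) = card (copies T x0 y0 \<Gamma> x' y')"
  proof (cases "(x0, y0) \<in> parcs T \<longleftrightarrow> (x, y) \<in> parcs \<Gamma>")
    case True
    then have "(x0, y0) \<in> parcs T \<longleftrightarrow> (x', y') \<in> parcs \<Gamma>" using xy by blast
    then show ?thesis
      using True card_copy_sets_eq[of x y x' y'] cop[OF V(1,2)] cop[OF V(3,4)] V xy by simp
  next
    case False
    then show ?thesis using cop[OF V(1,2)] cop[OF V(3,4)] xy by simp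
  qed
qed

section \<open>Counting vectors of given norm\<close>

text \<open>If 2 vanished, the odd number \<open>CARD('k)\<close> would equal 1 in the field. But
  the shift by 1 permutes the field and so preserves the sum of its elements, whence
  \<open>CARD('k)\<close> equals 0 there.\<close>

lemma two_neq_0_of_odd_card:
  assumes "odd CARD('k::{field,finite})"
  shows "(2::'k) \<noteq> 0"
proof
  assume 2: "(2::'k) = 0"
  obtain j where "CARD('k) = 2 * j + 1" using assms by (rule oddE)
  then have "(of_nat CARD('k) :: 'k) = 2 * of_nat j + 1" by simp
  also have "\<dots> = 1" using 2 by simp
  finally have "(of_nat CARD('k) :: 'k) = 1" .
  moreover have "(of_nat CARD('k) :: 'k) = 0"
  proof -
    have "bij (\<lambda>x::'k. x + 1)" by (rule o_bij[of "\<lambda>x. x - 1"]) auto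
    then have "(\<Sum>x\<in>UNIV. x + 1) = (\<Sum>x\<in>UNIV. x :: 'k)" by (rule sum.reindex_bij_betw)
    then show ?thesis by (simp add: sum.distrib)
  qed
  ultimately show False by simp
qed

lemma card_sum_fibers:
  fixes f :: "'a \<Rightarrow> 'b::finite"
  assumes "finite A"
  shows "card A = (\<Sum>r\<in>UNIV. card {a \<in> A. f a = r})"
  using sum.group[of A "UNIV :: 'b set" f "\<lambda>_. 1::nat"] assms by simp

lemma sum_if_const_neq:
  fixes a :: "'b::finite" and h :: "'b \<Rightarrow> nat"
  assumes "\<And>r. r \<noteq> a \<Longrightarrow> h r = c"
  shows "(\<Sum>r\<in>UNIV. h r) = h a + (CARD('b) - 1) * c"
proof -
  have "(\<Sum>r\<in>UNIV. h r) = h a + (\<Sum>r\<in>UNIV - {a}. h r)" by (simp add: sum.remove)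
  also have "(\<Sum>r\<in>UNIV - {a}. h r) = (\<Sum>r\<in>UNIV - {a}. c)" by (rule sum.cong) (use assms in auto)
  finally show ?thesis by (simp add: card_Diff_subset)
qed

section \<open>Binary quadratic forms over a finite field\<close>

definition binary_count :: "'k::{field,finite} \<Rightarrow> 'k \<Rightarrow> 'k \<Rightarrow> nat" where
  "binary_count a b r = card {(s, t). a * s\<^sup>2 + b * t\<^sup>2 = r}"

lemma card_squares:
  "CARD('k::{field,finite}) + 1 \<le> 2 * card (range (\<lambda>x::'k. x\<^sup>2))"
proof -
  let ?S = "range (\<lambda>x::'k. x\<^sup>2)"
  have fib: "card {x::'k. x\<^sup>2 = y} \<le> 2" if "y \<in> ?S" for y
  proof -
    obtain z where "y = z\<^sup>2" using \<open>y \<in> ?S\<close> by (rule imageE)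
    then have "{x. x\<^sup>2 = y} = {z, - z}" by (auto simp: power2_eq_iff)
    then show ?thesis by (simp add: card_insert_if)
  qed
  have "CARD('k) = (\<Sum>y\<in>?S. card {x::'k. x\<^sup>2 = y})"
    using sum.image_gen[of "UNIV::'k set" "\<lambda>_. 1::nat" "\<lambda>x. x\<^sup>2"] by simp
  also have "\<dots> = card {x::'k. x\<^sup>2 = 0} + (\<Sum>y\<in>?S - {0}. card {x::'k. x\<^sup>2 = y})"
    by (rule sum.remove) (auto intro: range_eqI[of _ _ 0])
  also have "\<dots> \<le> 1 + (\<Sum>y\<in>?S - {0}. 2)"
    using fib by (intro add_mono sum_mono) auto
  also have "\<dots> = 1 + 2 * (card ?S - 1)"
    by (subst sum_constant, subst card_Diff_singleton) (auto intro: range_eqI[of _ _ 0])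
  finally have "CARD('k) \<le> 1 + 2 * (card ?S - 1)" .
  moreover have "card ?S > 0" by (simp add: card_gt_0_iff)
  ultimately show ?thesis by linarith
qed

text \<open>Pigeonhole: the squares and the elements \<open>\<rho> - d * y\<^sup>2\<close> each fill
  more than half of the field, so the two sets meet.\<close>

lemma norm_form_represents:
  fixes d \<rho> :: "'k::{field,finite}"
  assumes "d \<noteq> 0"
  obtains x y where "x\<^sup>2 + d * y\<^sup>2 = \<rho>"
proof -
  let ?S = "range (\<lambda>x::'k. x\<^sup>2)" and ?T = "(\<lambda>y. \<rho> - d * y) ` range (\<lambda>x::'k. x\<^sup>2)"
  have "card ?T = card ?S" by (rule card_image) (use assms in \<open>auto simp: inj_on_def\<close>)
  have "?S \<inter> ?T \<noteq> {}"
  proof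
    assume "?S \<inter> ?T = {}"
    then have "card (?S \<union> ?T) = card ?S + card ?S" using \<open>card ?T = card ?S\<close> by (simp add: card_Un_disjoint)
    moreover have "card (?S \<union> ?T) \<le> CARD('k)" by (rule card_mono) auto
    ultimately show False using card_squares[where 'k='k] by linarith
  qed
  then obtain x y where "x\<^sup>2 = \<rho> - d * y\<^sup>2" by auto
  then show thesis using that[of x y] by simp
qed

text \<open>Multiplication by an element of norm \<open>\<rho>\<close> of the ring \<open>k[X]/(X\<^sup>2 + d)\<close>.\<close>

lemma norm_form_count_le:
  fixes d \<rho> :: "'k::{field,finite}"
  assumes "d \<noteq> 0" "\<rho> \<noteq> 0"
  shows "card {(x, y). x\<^sup>2 + d * y\<^sup>2 = k} \<le> card {(x, y). x\<^sup>2 + d * y\<^sup>2 = \<rho> * k}"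
proof -
  obtain a b where ab: "a\<^sup>2 + d * b\<^sup>2 = \<rho>" using norm_form_represents[OF assms(1)] .
  let ?g = "\<lambda>(x, y). (a * x - d * b * y, a * y + b * x)"
  have "inj ?g"
  proof (rule injI)
    fix p p' assume "?g p = ?g p'"
    moreover obtain x y x' y' where p: "p = (x, y)" "p' = (x', y')" by (cases p, cases p')
    ultimately have e: "a * x - d * b * y = a * x' - d * b * y'" "a * y + b * x = a * y' + b * x'" by auto
    \<comment> \<open>Multiplication by the conjugate of the element with coordinates
      \<open>a, b\<close> recovers \<open>\<rho>\<close> times each coordinate.\<close>
    have "\<rho> * x = a * (a * x - d * b * y) + d * b * (a * y + b * x)"
      unfolding ab[symmetric] by (simp add: algebra_simps power2_eq_square)
    also have "\<dots> = \<rho> * x'" unfolding e ab[symmetric] by (simp add: algebra_simps power2_eq_square)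
    finally have "x = x'" using assms(2) by simp
    have "\<rho> * y = a * (a * y + b * x) - b * (a * x - d * b * y)"
      unfolding ab[symmetric] by (simp add: algebra_simps power2_eq_square)
    also have "\<dots> = \<rho> * y'" unfolding e ab[symmetric] by (simp add: algebra_simps power2_eq_square)
    finally have "y = y'" using assms(2) by simp
    then show "p = p'" using p \<open>x = x'\<close> by simp
  qed
  moreover have "(a * x - d * b * y)\<^sup>2 + d * (a * y + b * x)\<^sup>2 = \<rho> * (x\<^sup>2 + d * y\<^sup>2)" for x y
    unfolding ab[symmetric] by (simp add: algebra_simps power2_eq_square)
  ultimately show ?thesis
    by (intro card_inj_on_le[of ?g]) (auto intro: inj_on_subset)
qed

text \<open>Multiplied by \<open>a\<close>, the form becomes the norm form
  \<open>x\<^sup>2 + (a * b) * y\<^sup>2\<close> with \<open>x = a * s\<close>. Elements of norm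
  \<open>r' / r\<close> and \<open>r / r'\<close> then give inequalities in both directions.\<close>

lemma binary_count_const:
  assumes "a \<noteq> 0" "b \<noteq> 0" "r \<noteq> 0" "r' \<noteq> 0"
  shows "binary_count a b r = binary_count a b r'"
proof -
  have eq: "binary_count a b r = card {(x, y). x\<^sup>2 + (a * b) * y\<^sup>2 = a * r}" for r
    unfolding binary_count_def
  proof (rule bij_betw_same_card[of "\<lambda>(s, t). (a * s, t)"], rule bij_betw_byWitness[of _ "\<lambda>(x, y). (x / a, y)"])
    have *: "(a * s)\<^sup>2 + (a * b) * t\<^sup>2 = a * (a * s\<^sup>2 + b * t\<^sup>2)" for s t
      by (simp add: algebra_simps power2_eq_square)
    show "(\<lambda>(s, t). (a * s, t)) ` {(s, t). a * s\<^sup>2 + b * t\<^sup>2 = r} \<subseteq> {(x, y). x\<^sup>2 + (a * b) * y\<^sup>2 = a * r}"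
      using * by auto
    have "a * (a * (x / a)\<^sup>2 + b * y\<^sup>2) = x\<^sup>2 + (a * b) * y\<^sup>2" for x y
      using assms(1) by (simp add: field_simps power2_eq_square)
    then show "(\<lambda>(x, y). (x / a, y)) ` {(x, y). x\<^sup>2 + (a * b) * y\<^sup>2 = a * r} \<subseteq> {(s, t). a * s\<^sup>2 + b * t\<^sup>2 = r}"
      using assms(1) by auto (metis mult_left_cancel)
  qed (use assms(1) in auto)
  have le: "binary_count a b r \<le> binary_count a b r'" if "r \<noteq> 0" "r' \<noteq> 0" for r r'
    unfolding eq using norm_form_count_le[of "a * b" "r' / r" "a * r"] assms(1,2) that
    by (simp add: mult.commute[of a])
  show ?thesis using le[OF assms(3,4)] le[OF assms(4,3)] by (rule antisym)
qed

section \<open>Orthogonal splitting and the distribution of values of Q\<close>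

locale odd_quadratic_space = quadratic_space scale Q
  for scale :: "'k::{field,finite} \<Rightarrow> 'v::ab_group_add \<Rightarrow> 'v" (infixr \<open>*s\<close> 75)
    and Q :: "'v \<Rightarrow> 'k" +
  assumes two_neq_0: "(2::'k) \<noteq> 0"
    and finite_space: "finite (UNIV :: 'v set)"
begin

abbreviation B :: "'v \<Rightarrow> 'v \<Rightarrow> 'k" where
  "B \<equiv> polar Q"

lemma finite_vectors [simp, intro]: "finite (A :: 'v set)"
  using finite_space by (rule rev_finite_subset) simp

lemma card_field_gt_1: "1 < CARD('k)"
proof -
  have "card {0, 1::'k} \<le> CARD('k)" by (rule card_mono) auto
  then show ?thesis by simp
qed

lemma polar_commute: "B u v = B v u"
  by (simp add: polar_def add.commute)

lemma polar_add_right: "B u (v + w) = B u v + B u w"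
  and polar_scale_right: "B u (a *s v) = a * B u v"
proof -
  interpret L: Vector_Spaces.linear "(*s)" "(*)" "B u" by (rule linear_polar)
  show "B u (v + w) = B u v + B u w" "B u (a *s v) = a * B u v" by (rule L.add L.scale)+
qed

lemma polar_add_left: "B (v + w) u = B v u + B w u"
  and polar_scale_left: "B (a *s v) u = a * B v u"
  by (simp_all add: polar_commute[of _ u] polar_add_right polar_scale_right)

lemma polar_zero [simp]: "B u 0 = 0" "B 0 u = 0"
  using polar_scale_right[of u 0 0] polar_scale_left[of 0 0 u] by simp_all

lemma polar_minus_right: "B u (- v) = - B u v"
  and polar_minus_left: "B (- v) u = - B v u"
  using polar_scale_right[of u "- 1" v] polar_scale_left[of "- 1" v u] by simp_all

lemma polar_diff_right: "B u (v - w) = B u v - B u w"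
  and polar_diff_left: "B (v - w) u = B v u - B w u"
  using polar_add_right[of u v "- w"] polar_add_left[of v "- w" u]
  by (simp_all add: polar_minus_right polar_minus_left)

lemmas polar_linear = polar_add_right polar_add_left polar_scale_right polar_scale_left
  polar_minus_right polar_minus_left polar_diff_right polar_diff_left

lemma Q_add: "Q (u + v) = Q u + Q v + B u v"
  by (simp add: polar_def)

lemma Q_zero [simp]: "Q 0 = 0"
  using Q_scale[of 0 0] by simp

lemma Q_minus [simp]: "Q (- v) = Q v"
  using Q_scale[of "- 1" v] by simp

lemma Q_diff: "Q (u - v) = Q u + Q v - B u v"
  using Q_add[of u "- v"] by (simp add: polar_minus_right)

lemma polar_self: "B v v = 2 * Q v"
  using Q_minus[of v] Q_diff[of v v] by simp

lemmas Q_expand = Q_add Q_diff Q_scale Q_minus polar_linear polar_self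

definition represents :: "'v set \<Rightarrow> 'k \<Rightarrow> nat" where
  "represents W r = card {v \<in> W. Q v = r}"

lemma card_eq_sum_represents: "card W = (\<Sum>r\<in>UNIV. represents W r)"
  unfolding represents_def by (rule card_sum_fibers) simp

text \<open>Translation by a multiple of \<open>a\<close> carries any fibre of \<open>B v\<close> on
  \<open>L\<close> to any other, so all fibres have the same size.\<close>

lemma card_polar_fiber:
  assumes "subspace L" "a \<in> L" "B v a \<noteq> 0"
  shows "CARD('k) * card {l \<in> L. B v l = r} = card L"
proof -
  have eq: "card {l \<in> L. B v l = s} = card {l \<in> L. B v l = r}" for s
  proof (rule bij_betw_same_card[of "\<lambda>l. l + ((r - s) / B v a) *s a"],
      rule bij_betw_byWitness[of _ "\<lambda>l. l + ((s - r) / B v a) *s a"])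
    have "(r - s) / B v a + (s - r) / B v a = 0" using assms(3) by (simp add: field_simps)
    then have "((r - s) / B v a) *s a + ((s - r) / B v a) *s a = 0" by (metis scale_left_distrib scale_zero_left)
    then show "\<forall>l\<in>{l \<in> L. B v l = s}. l + ((r - s) / B v a) *s a + ((s - r) / B v a) *s a = l"
      "\<forall>l\<in>{l \<in> L. B v l = r}. l + ((s - r) / B v a) *s a + ((r - s) / B v a) *s a = l"
      by (simp_all add: add.assoc add.commute)
  qed (use assms in \<open>auto simp: polar_linear subspace_add subspace_scale\<close>)
  have "card L = (\<Sum>s\<in>UNIV. card {l \<in> L. B v l = s})" by (rule card_sum_fibers) simp
  also have "\<dots> = (\<Sum>s\<in>(UNIV::'k set). card {l \<in> L. B v l = r})" by (rule sum.cong[OF refl eq])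
  finally show ?thesis by simp
qed

lemma subspace_polar: "subspace W \<Longrightarrow> subspace {w \<in> W. B u w = 0}"
  by (auto simp: subspace_def polar_linear)

lemma orthogonal_projection:
  assumes "Q u \<noteq> 0"
  shows "B u (v - (B u v / (2 * Q u)) *s u) = 0"
  using assms two_neq_0 by (simp add: polar_linear polar_self)

text \<open>A vector of \<open>W\<close> differs from its projection to the complement of
  \<open>u\<close> by a multiple of \<open>u\<close>, and \<open>w\<close> is orthogonal to
  \<open>u\<close>. So a vector in the radical of the complement is in the radical of
  \<open>W\<close>.\<close>

lemma nondegenerate_polar:
  assumes W: "subspace W" "nondegenerate W" and u: "u \<in> W" "Q u \<noteq> 0"
  shows "nondegenerate {w \<in> W. B u w = 0}"
  unfolding nondegenerate_def
proof (intro ballI impI)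
  fix w assume w: "w \<in> {w \<in> W. B u w = 0}" and 0: "\<forall>v\<in>{w \<in> W. B u w = 0}. B w v = 0"
  have "B w v = 0" if "v \<in> W" for v
  proof -
    let ?v = "v - (B u v / (2 * Q u)) *s u"
    have "?v \<in> {w \<in> W. B u w = 0}"
      using W u that orthogonal_projection[of u v] by (simp add: subspace_diff subspace_scale)
    then have "B w ?v = 0" using 0 by blast
    then show ?thesis using w by (simp add: polar_linear polar_commute[of w u])
  qed
  then show "w = 0" using W w by (auto simp: nondegenerate_def)
qed

text \<open>The splitting of \<open>W\<close> into the line of \<open>u\<close> and its complement.
  The predicate \<open>P\<close> lets the same bijection count all vectors as well as those of given
  norm.\<close>

lemma split_bij:
  assumes W: "subspace W" and u: "u \<in> W" "Q u \<noteq> 0"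
  shows "bij_betw (\<lambda>(t, w). t *s u + w) (SIGMA t:UNIV. {w \<in> {w \<in> W. B u w = 0}. P (t *s u + w)}) {v \<in> W. P v}"
proof (rule bij_betw_byWitness[of _ "\<lambda>v. (B u v / (2 * Q u), v - (B u v / (2 * Q u)) *s u)"])
  show "\<forall>p\<in>(SIGMA t:UNIV. {w \<in> {w \<in> W. B u w = 0}. P (t *s u + w)}).
     (\<lambda>v. (B u v / (2 * Q u), v - (B u v / (2 * Q u)) *s u)) ((\<lambda>(t, w). t *s u + w) p) = p"
    using u two_neq_0 by (auto simp: polar_linear polar_self)
  show "(\<lambda>v. (B u v / (2 * Q u), v - (B u v / (2 * Q u)) *s u)) ` {v \<in> W. P v}
      \<subseteq> (SIGMA t:UNIV. {w \<in> {w \<in> W. B u w = 0}. P (t *s u + w)})"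
    using W u orthogonal_projection[of u] by (auto simp: subspace_diff subspace_scale)
qed (use W u in \<open>auto simp: subspace_add subspace_scale\<close>)

lemma card_split:
  assumes "subspace W" "u \<in> W" "Q u \<noteq> 0"
  shows "card W = CARD('k) * card {w \<in> W. B u w = 0}"
proof -
  have "card {v \<in> W. True} = card (SIGMA t:(UNIV::'k set). {w \<in> {w \<in> W. B u w = 0}. True})"
    using bij_betw_same_card[OF split_bij[OF assms, of "\<lambda>_. True"]] by simp
  then show ?thesis by (simp add: card_cartesian_product)
qed

lemma represents_split:
  assumes "subspace W" "u \<in> W" "Q u \<noteq> 0"
  shows "represents W r = (\<Sum>t\<in>UNIV. represents {w \<in> W. B u w = 0} (r - t\<^sup>2 * Q u))"
proof -
  have "represents W r = card (SIGMA t:(UNIV::'k set). {w \<in> {w \<in> W. B u w = 0}. Q (t *s u + w) = r})"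
    unfolding represents_def using bij_betw_same_card[OF split_bij[OF assms, of "\<lambda>v. Q v = r"]] by simp
  also have "(SIGMA t:(UNIV::'k set). {w \<in> {w \<in> W. B u w = 0}. Q (t *s u + w) = r}) =
      (SIGMA t:(UNIV::'k set). {w \<in> {w \<in> W. B u w = 0}. Q w = r - t\<^sup>2 * Q u})"
    by (auto simp: Q_expand)
  finally show ?thesis by (simp add: represents_def)
qed

lemma nonsingular_vector:
  assumes "subspace W" "nondegenerate W" "card W > 1"
  obtains u where "u \<in> W" "Q u \<noteq> 0"
proof -
  obtain w where w: "w \<in> W" "w \<noteq> 0"
    using assms(3) by (metis card_1_singleton_iff card_eq_0_iff less_numeral_extra(4) not_one_less_zero
        subsetI subset_singletonD singletonI One_nat_def)
  show thesis
  proof (cases "\<forall>v\<in>W. Q v = 0")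
    case True
    then have "B w v = 0" if "v \<in> W" for v
      using that w assms(1) by (simp add: polar_def subspace_add)
    then show thesis using assms(2) w by (auto simp: nondegenerate_def)
  qed (use that in blast)
qed

text \<open>Two nonsingular vectors are split off at a time, because a binary form takes all nonzero
  values equally often. A distribution \<open>d + e * of_bool (r = 0)\<close> on the remaining space
  turns into q^2 \<open>d\<close> plus \<open>e\<close> times the binary count, which again depends
  only on whether \<open>r\<close> is 0. The induction starts at the zero space with
  \<open>d = 0\<close> and \<open>e = 1\<close>.\<close>

lemma represents_even:
  assumes "subspace W" "nondegenerate W" "card W = CARD('k) ^ (2 * j)"
  obtains d e :: int where "\<And>r. int (represents W r) = d + e * of_bool (r = 0)"
  using assms
proof (induction j arbitrary: W thesis)
  case 0
  then have "W = {0}" using subspace_0[of W] by (auto simp: card_1_singleton_iff)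
  then have "int (represents W r) = 0 + 1 * of_bool (r = 0)" for r
    by (auto simp: represents_def Collect_conv_if)
  then show ?case by (rule 0)
next
  case (Suc j)
  have pow_gt_1: "1 < CARD('k) ^ Suc n" for n using card_field_gt_1 by (rule one_less_power) simp
  obtain u where u: "u \<in> W" "Q u \<noteq> 0"
    using nonsingular_vector[OF Suc.prems(2,3)] Suc.prems(4) pow_gt_1[of "Suc (2 * j)"] by auto
  define U where "U = {w \<in> W. B u w = 0}"
  have U: "subspace U" "nondegenerate U" and cU: "card W = CARD('k) * card U"
    unfolding U_def using subspace_polar nondegenerate_polar card_split Suc.prems u by auto
  then have cU: "card U = CARD('k) ^ Suc (2 * j)" using Suc.prems(4) card_field_gt_1 by simp
  obtain v where v: "v \<in> U" "Q v \<noteq> 0"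
    using nonsingular_vector[OF U] cU pow_gt_1[of "2 * j"] by auto
  define X where "X = {w \<in> U. B v w = 0}"
  have X: "subspace X" "nondegenerate X" and cX: "card U = CARD('k) * card X"
    unfolding X_def using subspace_polar nondegenerate_polar card_split U v by auto
  then have "card X = CARD('k) ^ (2 * j)" using cU card_field_gt_1 by simp
  from Suc.IH[OF _ X this] obtain d e where de: "\<And>r. int (represents X r) = d + e * of_bool (r = 0)"
    by blast
  have "int (represents W r) = (CARD('k) * CARD('k)) * d + e * binary_count (Q u) (Q v) r" for r
  proof -
    have "int (represents W r) = (\<Sum>s\<in>UNIV. \<Sum>t\<in>UNIV. int (represents X (r - s\<^sup>2 * Q u - t\<^sup>2 * Q v)))"
      by (simp add: represents_split[OF Suc.prems(2) u, folded U_def] represents_split[OF U(1) v, folded X_def])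
    also have "\<dots> = (\<Sum>p\<in>UNIV \<times> UNIV. d + e * of_bool (r - (fst p)\<^sup>2 * Q u - (snd p)\<^sup>2 * Q v = 0))"
      unfolding de by (simp add: sum.cartesian_product split_def)
    also have "\<dots> = (CARD('k) * CARD('k)) * d + e * (\<Sum>p\<in>UNIV \<times> UNIV. of_bool (r - (fst p)\<^sup>2 * Q u - (snd p)\<^sup>2 * Q v = 0))"
      by (simp add: sum.distrib sum_distrib_left card_cartesian_product)
    also have "(\<Sum>p\<in>UNIV \<times> UNIV. of_bool (r - (fst p)\<^sup>2 * Q u - (snd p)\<^sup>2 * Q v = 0)) =
        int (card {p \<in> UNIV \<times> UNIV. r - (fst p)\<^sup>2 * Q u - (snd p)\<^sup>2 * Q v = 0})"
      by (subst card_eq_sum) (simp add: of_bool_def sum.If_cases Int_def del: UNIV_Times_UNIV)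
    also have "{p \<in> UNIV \<times> UNIV. r - (fst p)\<^sup>2 * Q u - (snd p)\<^sup>2 * Q v = 0} =
        {(s, t). Q u * s\<^sup>2 + Q v * t\<^sup>2 = r}"
      by (auto simp: algebra_simps)
    finally show ?thesis by (simp add: binary_count_def)
  qed
  note count = this
  have "binary_count (Q u) (Q v) r = binary_count (Q u) (Q v) 1" if "r \<noteq> 0" for r
    by (rule binary_count_const) (use u v that in auto)
  note const = this
  have "int (represents W r) = ((CARD('k) * CARD('k)) * d + e * binary_count (Q u) (Q v) 1) +
      (e * (int (binary_count (Q u) (Q v) 0) - int (binary_count (Q u) (Q v) 1))) * of_bool (r = 0)" for r
    using count[of r] const[of r] by (cases "r = 0") (simp_all add: right_diff_distrib)
  then show ?case by (rule Suc.prems(1))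
qed


lemma card_eq_of_represents:
  fixes d e :: int
  assumes "\<And>r. int (represents W r) = d + e * of_bool (r = 0)"
  shows "int (card W) = CARD('k) * d + e"
proof -
  have "int (card W) = (\<Sum>r\<in>UNIV. int (represents W r))"
    by (simp add: card_eq_sum_represents)
  also have "\<dots> = CARD('k) * d + e * (\<Sum>r\<in>(UNIV::'k set). of_bool (r = 0))"
    by (simp add: assms sum.distrib sum_distrib_left)
  also have "(\<Sum>r\<in>(UNIV::'k set). of_bool (r = 0)) = (1::int)" by (simp add: of_bool_def)
  finally show ?thesis by simp
qed

text \<open>In a nondegenerate space of dimension 2j this is the coefficient \<open>e\<close> of
  \<open>represents_even\<close>. It equals q^j for hyperbolic and -q^j for elliptic spaces, and so
  detects the type.\<close>

definition excess :: "'v set \<Rightarrow> int" where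
  "excess W = int (represents W 0) - int (represents W 1)"

lemma represents_even_excess:
  assumes "subspace W" "nondegenerate W" "card W = CARD('k) ^ (2 * j)"
  shows "CARD('k) * int (represents W r) = card W - excess W + CARD('k) * excess W * of_bool (r = 0)"
proof -
  from represents_even[OF assms] obtain d e where de: "\<And>r. int (represents W r) = d + e * of_bool (r = 0)"
    by blast
  then have "excess W = e" by (simp add: excess_def)
  then show ?thesis using de[of r] card_eq_of_represents[OF de] by (simp add: algebra_simps)
qed

text \<open>After splitting off \<open>u\<close>, zeros over the coordinate \<open>t\<close> come
  from vectors of norm \<open>- t\<^sup>2 * Q u\<close> in the even-dimensional complement
  \<open>W\<close>. This norm is 0 only for \<open>t = 0\<close>, so the sum is q
  \<open>d + e\<close>, the size of \<open>W\<close>.\<close>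

lemma represents_odd_zero:
  assumes U: "subspace U" "nondegenerate U" and c: "card U = CARD('k) ^ Suc (2 * j)"
  shows "CARD('k) * represents U 0 = card U"
proof -
  have "1 < card U" unfolding c using card_field_gt_1 by (rule one_less_power) simp
  then obtain u where u: "u \<in> U" "Q u \<noteq> 0" using nonsingular_vector[OF U] by blast
  define W where "W = {w \<in> U. B u w = 0}"
  have W: "subspace W" "nondegenerate W" "card U = CARD('k) * card W"
    unfolding W_def using subspace_polar nondegenerate_polar card_split U u by auto
  then have cW: "card W = CARD('k) ^ (2 * j)" using c card_field_gt_1 by simp
  from represents_even[OF W(1,2) cW] obtain d e where de: "\<And>r. int (represents W r) = d + e * of_bool (r = 0)"
    by blast
  have "int (represents U 0) = (\<Sum>t\<in>UNIV. int (represents W (0 - t\<^sup>2 * Q u)))"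
    by (simp add: represents_split[OF U(1) u, folded W_def])
  also have "\<dots> = CARD('k) * d + e * (\<Sum>t\<in>(UNIV::'k set). of_bool (t = 0))"
    using u by (simp add: de sum.distrib sum_distrib_left)
  also have "(\<Sum>t\<in>(UNIV::'k set). of_bool (t = 0)) = (1::int)" by (simp add: of_bool_def)
  finally have "represents U 0 = card W" using card_eq_of_represents[OF de] by simp
  then show ?thesis using W by simp
qed

text \<open>\<open>Q\<close> is equidistributed on each coset \<open>v + L\<close> with \<open>v\<close> not orthogonal to \<open>L\<close>, and constant
  on the others.\<close>

lemma represents_totally_singular:
  fixes W L :: "'v set"
  assumes W: "subspace W" and L: "totally_singular L" "L \<subseteq> W"
  defines "M \<equiv> {v \<in> W. \<forall>l\<in>L. B v l = 0}"
  shows "CARD('k) * represents W r + card M = card W + CARD('k) * represents M r"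
proof -
  have sL: "subspace L" and QL: "\<And>l. l \<in> L \<Longrightarrow> Q l = 0" using L by (auto simp: totally_singular_def)
  have L0: "card L > 0" using subspace_0[OF sL] by (auto simp: card_gt_0_iff)
  have *: "card {v \<in> W. Q (v + l) = r} = represents W r" if l: "l \<in> L" for l
    unfolding represents_def
    by (rule bij_betw_same_card[of "\<lambda>v. v + l"], rule bij_betw_byWitness[of _ "\<lambda>v. v - l"])
      (use l L W in \<open>auto simp: subspace_add subspace_diff\<close>)
  \<comment> \<open>Averaging over the translations by \<open>L\<close> and exchanging the sums
    leaves, for each \<open>v\<close>, the count of \<open>l\<close> with
    \<open>B v l = r - Q v\<close>, as \<open>Q l = 0\<close>.\<close>
  have "card L * represents W r = (\<Sum>l\<in>L. card {v \<in> W. Q (v + l) = r})" using * by simp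
  also have "\<dots> = card (SIGMA l:L. {v \<in> W. Q (v + l) = r})" by simp
  also have "\<dots> = card (SIGMA v:W. {l \<in> L. Q (v + l) = r})"
    by (rule bij_betw_same_card[of prod.swap]) (auto simp: bij_betw_def inj_on_def image_iff)
  also have "\<dots> = (\<Sum>v\<in>W. card {l \<in> L. B v l = r - Q v})"
    by (simp add: Q_add QL eq_diff_eq add.commute cong: conj_cong)
  also have "\<dots> = (\<Sum>v\<in>W - M. card {l \<in> L. B v l = r - Q v}) + (\<Sum>v\<in>M. card {l \<in> L. B v l = r - Q v})"
    by (rule sum.subset_diff) (auto simp: M_def)
  also have "(\<Sum>v\<in>M. card {l \<in> L. B v l = r - Q v}) = (\<Sum>v\<in>M. if Q v = r then card L else 0)"
    by (rule sum.cong) (auto simp: M_def intro!: arg_cong[of _ _ card])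
  also have "\<dots> = represents M r * card L"
    by (simp add: sum.If_cases represents_def Int_def)
  finally have "CARD('k) * (card L * represents W r) =
      (\<Sum>v\<in>W - M. CARD('k) * card {l \<in> L. B v l = r - Q v}) + CARD('k) * (represents M r * card L)"
    by (simp add: distrib_left sum_distrib_left)
  also have "(\<Sum>v\<in>W - M. CARD('k) * card {l \<in> L. B v l = r - Q v}) = (\<Sum>v\<in>W - M. card L)"
    by (rule sum.cong) (auto simp: M_def intro!: card_polar_fiber[OF sL])
  also have "\<dots> = (card W - card M) * card L"
    by (simp add: card_Diff_subset M_def)
  finally have "(CARD('k) * represents W r) * card L = (card W - card M + CARD('k) * represents M r) * card L"
    by (simp add: algebra_simps)
  then have "CARD('k) * represents W r = card W - card M + CARD('k) * represents M r"
    using L0 by (auto simp: card_gt_0_iff)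
  moreover have "card M \<le> card W" by (rule card_mono) (auto simp: M_def)
  ultimately show ?thesis by linarith
qed

text \<open>Count the orthogonal pairs in \<open>W \<times> L\<close> in two ways.\<close>

lemma card_polar_complement:
  fixes W L :: "'v set"
  assumes W: "subspace W" "nondegenerate W" and L: "subspace L" "L \<subseteq> W"
  defines "M \<equiv> {v \<in> W. \<forall>l\<in>L. B v l = 0}"
  shows "card M * card L = card W"
proof -
  have MW: "M \<subseteq> W" "card M \<le> card W" by (auto simp: M_def intro: card_mono)
  have L0: "card L > 0" using subspace_0[OF L(1)] by (auto simp: card_gt_0_iff)
  let ?Z = "(\<Sum>v\<in>W. card {l \<in> L. B v l = 0})"
  have "?Z = card (SIGMA v:W. {l \<in> L. B v l = 0})" by simp
  also have "\<dots> = card (SIGMA l:L. {v \<in> W. B l v = 0})"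
    by (rule bij_betw_same_card[of prod.swap])
      (auto simp: bij_betw_def inj_on_def image_iff polar_commute)
  also have "\<dots> = (\<Sum>l\<in>L. card {v \<in> W. B l v = 0})" by simp
  also have "\<dots> = card W + (\<Sum>l\<in>L - {0}. card {v \<in> W. B l v = 0})"
    using subspace_0[OF L(1)] by (subst sum.remove[of _ 0]) auto
  finally have "CARD('k) * ?Z = CARD('k) * card W + (\<Sum>l\<in>L - {0}. CARD('k) * card {v \<in> W. B l v = 0})"
    by (simp add: distrib_left sum_distrib_left)
  also have "(\<Sum>l\<in>L - {0}. CARD('k) * card {v \<in> W. B l v = 0}) = (\<Sum>l\<in>L - {0}. card W)"
  proof (rule sum.cong[OF refl])
    fix l assume "l \<in> L - {0}"
    then obtain v where "v \<in> W" "B l v \<noteq> 0" using W(2) L(2) by (auto simp: nondegenerate_def)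
    then show "CARD('k) * card {v \<in> W. B l v = 0} = card W" by (rule card_polar_fiber[OF W(1)])
  qed
  also have "\<dots> = (card L - 1) * card W" using subspace_0[OF L(1)] by simp
  finally have 1: "CARD('k) * ?Z = CARD('k) * card W + (card L - 1) * card W" .
  have "?Z = (\<Sum>v\<in>W - M. card {l \<in> L. B v l = 0}) + (\<Sum>v\<in>M. card {l \<in> L. B v l = 0})"
    using MW by (intro sum.subset_diff) auto
  also have "(\<Sum>v\<in>M. card {l \<in> L. B v l = 0}) = (\<Sum>v\<in>M. card L)"
    by (rule sum.cong) (auto simp: M_def intro!: arg_cong[of _ _ card])
  finally have "CARD('k) * ?Z = (\<Sum>v\<in>W - M. CARD('k) * card {l \<in> L. B v l = 0}) + CARD('k) * (card M * card L)"
    by (simp add: distrib_left sum_distrib_left)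
  also have "(\<Sum>v\<in>W - M. CARD('k) * card {l \<in> L. B v l = 0}) = (\<Sum>v\<in>W - M. card L)"
    by (rule sum.cong) (auto simp: M_def intro!: card_polar_fiber[OF L(1)])
  also have "\<dots> = (card W - card M) * card L"
    using MW by (simp add: card_Diff_subset)
  finally have 2: "CARD('k) * ?Z = (card W - card M) * card L + CARD('k) * (card M * card L)" .
  \<comment> \<open>These differences remove the truncated subtractions. \<open>Suc k\<close> is q -
    1, the common factor that remains after equating the two counts.\<close>
  define k l w where "k = CARD('k) - 2" and "l = card L - 1" and "w = card W - card M"
  then have k: "CARD('k) = Suc (Suc k)" and l: "card L = Suc l" and w: "card W = card M + w"
    using card_field_gt_1 L0 MW by auto
  have "Suc (Suc k) * (card M + w) + l * (card M + w) = w * Suc l + Suc (Suc k) * (card M * Suc l)"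
    using trans[OF 1[symmetric] 2] unfolding k l w by simp
  then have "Suc k * (card M + w) = Suc k * (card M * Suc l)"
    by (simp add: algebra_simps)
  then show ?thesis unfolding l w by (simp only: mult_cancel1) simp
qed

lemma card_span_independent:
  assumes "independent S"
  shows "card (span S) = CARD('k) ^ card S"
proof -
  have "finite S" by simp
  then show ?thesis using assms
  proof (induction S)
    case (insert a S)
    then have a: "a \<notin> span S" and S: "independent S" by (auto simp: independent_insert)
    have "bij_betw (\<lambda>(k, v). k *s a + v) (UNIV \<times> span S) (span (insert a S))"
      unfolding bij_betw_def
    proof
      show "inj_on (\<lambda>(k, v). k *s a + v) (UNIV \<times> span S)"
      proof (rule inj_onI, clarify)
        fix k v k' v' assume v: "v \<in> span S" "v' \<in> span S" and e: "k *s a + v = k' *s a + v'"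
        then have "(k - k') *s a = v' - v" by (simp add: scale_left_diff_distrib algebra_simps)
        then have *: "(k - k') *s a \<in> span S" using v by (simp add: span_diff)
        have "k = k'"
        proof (rule ccontr)
          assume "k \<noteq> k'"
          then have "a = (1 / (k - k')) *s ((k - k') *s a)" by simp
          then show False using a * by (metis span_scale)
        qed
        then show "k = k' \<and> v = v'" using e by simp
      qed
      show "(\<lambda>(k, v). k *s a + v) ` (UNIV \<times> span S) = span (insert a S)"
      proof (intro equalityI subsetI)
        fix x assume "x \<in> span (insert a S)"
        then obtain k where "x - k *s a \<in> span S" by (auto simp: span_insert)
        then show "x \<in> (\<lambda>(k, v). k *s a + v) ` (UNIV \<times> span S)"
          by (intro image_eqI[of _ _ "(k, x - k *s a)"]) auto
      next
        fix x assume "x \<in> (\<lambda>(k, v). k *s a + v) ` (UNIV \<times> span S)"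
        then obtain k v where "x = k *s a + v" "v \<in> span S" by auto
        then have "x - k *s a \<in> span S" by simp
        then show "x \<in> span (insert a S)" by (auto simp: span_insert)
      qed
    qed
    then have "card (span (insert a S)) = card ((UNIV :: 'k set) \<times> span S)" by (simp add: bij_betw_same_card)
    then show ?case using insert S by (simp add: card_cartesian_product)
  qed simp
qed

lemma card_subspace:
  assumes "subspace W"
  shows "card W = CARD('k) ^ dim W"
proof -
  obtain S where "S \<subseteq> W" "independent S" "W \<subseteq> span S" "card S = dim W" by (rule basis_exists)
  moreover then have "span S = W" using assms by (metis span_minimal subset_antisym)
  ultimately show ?thesis using card_span_independent by metis
qed

section \<open>Excess and Witt index\<close>

lemma finite_witt: "finite {dim L | L. L \<subseteq> W \<and> totally_singular L}"
proof -
  have "finite (Pow (UNIV :: 'v set))" by (simp only: finite_Pow_iff finite_vectors)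
  then show ?thesis by (rule finite_surj[of _ _ dim]) auto
qed

lemma witt_index_attained:
  assumes "subspace W"
  obtains L where "L \<subseteq> W" "totally_singular L" "dim L = witt_index W"
proof -
  have "totally_singular {0}" by (simp add: totally_singular_def subspace_single_0)
  then have "dim {0} \<in> {dim L | L. L \<subseteq> W \<and> totally_singular L}" using subspace_0[OF assms] by auto
  then have "witt_index W \<in> {dim L | L. L \<subseteq> W \<and> totally_singular L}"
    unfolding witt_index_def using finite_witt by (intro Max_in) auto
  then show thesis using that by auto
qed

text \<open>By \<open>represents_totally_singular\<close> the counts on \<open>W\<close> and on
  \<open>M\<close> differ by an amount independent of \<open>r\<close>. So \<open>M\<close> has the
  same excess and is also equidistributed on nonzero values; its size then expresses
  \<open>represents M 1\<close> through \<open>represents M 0\<close>.\<close>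

lemma excess_totally_singular:
  assumes W: "subspace W" "nondegenerate W" "card W = CARD('k) ^ (2 * j)"
    and L: "L \<subseteq> W" "totally_singular L"
  defines "M \<equiv> {v \<in> W. \<forall>l\<in>L. B v l = 0}"
  shows "(CARD('k) - 1) * excess W = CARD('k) * int (represents M 0) - card M"
proof -
  have const: "represents M r = represents M 1" if "r \<noteq> 0" for r
  proof -
    have "int CARD('k) * int (represents W r) = int CARD('k) * int (represents W 1)"
      using represents_even_excess[OF W, of r] represents_even_excess[OF W, of 1] that by simp
    then have "represents W r = represents W 1" by simp
    then show ?thesis
      using represents_totally_singular[OF W(1) L(2,1), of r] represents_totally_singular[OF W(1) L(2,1), of 1]
        card_field_gt_1 unfolding M_def by simp
  qed
  have "card M = represents M 0 + (CARD('k) - 1) * represents M 1"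
    unfolding card_eq_sum_represents[of M] by (rule sum_if_const_neq) (rule const)
  then have cM: "int (card M) = represents M 0 + (int CARD('k) - 1) * represents M 1"
    using card_field_gt_1 by (simp add: of_nat_diff)
  have "int (CARD('k) * represents W 0) - int (CARD('k) * represents W 1) =
      int (CARD('k) * represents M 0) - int (CARD('k) * represents M 1)"
    using represents_totally_singular[OF W(1) L(2,1), of 0] represents_totally_singular[OF W(1) L(2,1), of 1]
    unfolding M_def by linarith
  then have "int CARD('k) * excess W = int CARD('k) * (int (represents M 0) - int (represents M 1))"
    by (simp add: excess_def right_diff_distrib)
  then have "excess W = int (represents M 0) - int (represents M 1)" using card_field_gt_1 by simp
  then have "excess W = int (represents M 0) - int (represents M 1)" .
  moreover have "int (CARD('k) - 1) = int CARD('k) - 1" using card_field_gt_1 by (simp add: of_nat_diff)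
  ultimately show ?thesis unfolding cM by (simp add: left_diff_distrib right_diff_distrib)
qed

text \<open>A totally singular \<open>L\<close> of half the dimension has as many vectors as its
  orthogonal space in \<open>W\<close>, hence equals it. So \<open>Q\<close> vanishes on
  \<open>M\<close>, and the excess is \<open>card L\<close>.\<close>

lemma excess_hyperbolic:
  assumes "hyperbolic W"
  shows "excess W > 0"
proof -
  have W: "subspace W" "nondegenerate W" "dim W = 2 * witt_index W" using assms by (auto simp: hyperbolic_def)
  obtain L where L: "L \<subseteq> W" "totally_singular L" "dim L = witt_index W" using witt_index_attained W(1) .
  have sL: "subspace L" using L by (simp add: totally_singular_def)
  have c: "card W = CARD('k) ^ (2 * witt_index W)" "card L = CARD('k) ^ witt_index W"
    using card_subspace W L sL by auto
  define M where "M = {v \<in> W. \<forall>l\<in>L. B v l = 0}"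
  have "card M * card L = card L * card L"
    using card_polar_complement[OF W(1,2) sL L(1), folded M_def] unfolding c
    by (simp add: power_add mult_2)
  moreover have "card L > 0" using c card_field_gt_1 by simp
  ultimately have "card M = card L" by (auto simp: card_gt_0_iff)
  moreover have "L \<subseteq> M" using L sL by (auto simp: M_def totally_singular_def polar_def subspace_add)
  ultimately have "M = L" by (metis card_subset_eq finite_vectors)
  then have "represents M 0 = card L" using L by (auto simp: represents_def totally_singular_def intro!: arg_cong[of _ _ card])
  then have "(CARD('k) - 1) * excess W = CARD('k) * int (card L) - card L"
    using excess_totally_singular[OF W(1,2) c(1) L(1,2)] \<open>card M = card L\<close> unfolding M_def by simp
  also have "\<dots> = (CARD('k) - 1) * int (card L)" using card_field_gt_1 by (simp add: of_nat_diff algebra_simps)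
  finally have "excess W = int (card L)" using card_field_gt_1 by simp
  then show ?thesis using \<open>card L > 0\<close> by simp
qed

text \<open>Here \<open>M\<close> is q^2 times as large as \<open>L\<close>, while maximality of
  \<open>L\<close> leaves no singular vectors in \<open>M\<close> outside \<open>L\<close>. The
  excess becomes -q times \<open>card L\<close>.\<close>

lemma excess_elliptic:
  assumes "elliptic W"
  shows "excess W < 0"
proof -
  have W: "subspace W" "nondegenerate W" "dim W = 2 * (witt_index W + 1)" using assms by (auto simp: elliptic_def)
  obtain L where L: "L \<subseteq> W" "totally_singular L" "dim L = witt_index W" using witt_index_attained W(1) .
  have sL: "subspace L" using L by (simp add: totally_singular_def)
  have c: "card W = CARD('k) ^ (2 * (witt_index W + 1))" "card L = CARD('k) ^ witt_index W"
    using card_subspace W L sL by auto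
  define M where "M = {v \<in> W. \<forall>l\<in>L. B v l = 0}"
  have L0: "card L > 0" using c card_field_gt_1 by simp
  have "card M * card L = (CARD('k) * CARD('k) * card L) * card L"
    using card_polar_complement[OF W(1,2) sL L(1), folded M_def] unfolding c
    by (simp add: power_add mult_2)
  then have cM: "card M = CARD('k) * CARD('k) * card L" using L0 by (auto simp: card_gt_0_iff)
  \<comment> \<open>Otherwise \<open>v\<close> and \<open>L\<close> would span a larger totally
    singular subspace of \<open>W\<close>, against the choice of \<open>L\<close>.\<close>
  have "v \<in> L" if v: "v \<in> M" "Q v = 0" for v
  proof (rule ccontr)
    assume "v \<notin> L"
    let ?K = "span (insert v L)"
    have "?K \<subseteq> W" using v L W(1) by (intro span_minimal) (auto simp: M_def)
    moreover have "totally_singular ?K"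
      unfolding totally_singular_def
    proof (intro conjI ballI)
      fix w assume "w \<in> ?K"
      then obtain k where "w - k *s v \<in> L" by (auto simp: span_insert span_eq_iff[THEN iffD2, OF sL])
      then obtain l where "l \<in> L" "w = k *s v + l" by (metis add_diff_cancel_left' diff_add_cancel add.commute)
      then show "Q w = 0" using v L by (auto simp: Q_expand M_def totally_singular_def)
    qed simp
    ultimately have "dim ?K \<in> {dim L | L. L \<subseteq> W \<and> totally_singular L}" by blast
    then have "dim ?K \<le> dim L" unfolding L(3) witt_index_def using finite_witt by (intro Max_ge)
    moreover have "L \<subset> ?K" using \<open>v \<notin> L\<close> by (auto intro: span_base)
    then have "card L < card ?K" by (intro psubset_card_mono) auto
    then have "dim L < dim ?K" using card_subspace[OF sL] card_subspace[of ?K] card_field_gt_1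
      by (metis power_strict_increasing_iff subspace_span)
    ultimately show False by simp
  qed
  moreover have "L \<subseteq> M" using L sL by (auto simp: M_def totally_singular_def polar_def subspace_add)
  ultimately have "{v \<in> M. Q v = 0} = L" using L by (auto simp: totally_singular_def)
  then have "represents M 0 = card L" by (simp add: represents_def)
  then have "(CARD('k) - 1) * excess W = CARD('k) * int (card L) - CARD('k) * CARD('k) * card L"
    using excess_totally_singular[OF W(1,2) c(1) L(1,2)] cM unfolding M_def by simp
  also have "\<dots> = (CARD('k) - 1) * (- (CARD('k) * int (card L)))" using card_field_gt_1 by (simp add: of_nat_diff algebra_simps)
  finally have "excess W = - (CARD('k) * int (card L))" using card_field_gt_1 by (simp del: mult_minus_right)
  then show ?thesis using L0 card_field_gt_1 by simp
qed


section \<open>The type determines the square class\<close>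

lemma subspace_polar_UNIV: "subspace {v. B x v = 0}"
  using subspace_polar[OF subspace_UNIV, of x] by simp

lemma nondegenerate_polar_UNIV:
  "nondegenerate UNIV \<Longrightarrow> Q x \<noteq> 0 \<Longrightarrow> nondegenerate {v. B x v = 0}"
  using nondegenerate_polar[OF subspace_UNIV, of x] by simp

lemma card_polar_UNIV: "Q x \<noteq> 0 \<Longrightarrow> card (UNIV :: 'v set) = CARD('k) * card {v. B x v = 0}"
  using card_split[OF subspace_UNIV, of x] by simp

text \<open>Splitting off \<open>x\<close> leaves an even-dimensional space, whose exceptional value
  0 is needed once for every \<open>t\<close> with \<open>t\<^sup>2 * Q x = r\<close>.\<close>

lemma represents_UNIV:
  assumes nd: "nondegenerate UNIV" and c: "card (UNIV :: 'v set) = CARD('k) ^ (2 * m + 1)" and x: "Q x \<noteq> 0"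
  shows "int (represents UNIV r) =
    CARD('k) ^ (2 * m) + excess {v. B x v = 0} * (int (card {t. t\<^sup>2 * Q x = r}) - 1)"
proof -
  let ?W = "{v. B x v = 0}"
  have cW: "card ?W = CARD('k) ^ (2 * m)" using card_polar_UNIV[OF x] c card_field_gt_1 by simp
  note even = represents_even_excess[OF subspace_polar_UNIV nondegenerate_polar_UNIV[OF nd x] cW]
  have "CARD('k) * int (represents UNIV r) = (\<Sum>t\<in>UNIV. CARD('k) * int (represents ?W (r - t\<^sup>2 * Q x)))"
    using represents_split[OF subspace_UNIV, of x r] x by (simp add: sum_distrib_left)
  also have "\<dots> = CARD('k) * (card ?W - excess ?W) +
      CARD('k) * excess ?W * (\<Sum>t\<in>(UNIV::'k set). of_bool (r - t\<^sup>2 * Q x = 0))"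
    unfolding even by (simp add: sum.distrib sum_distrib_left)
  also have "(\<Sum>t\<in>(UNIV::'k set). of_bool (r - t\<^sup>2 * Q x = 0)) = int (card {t. t\<^sup>2 * Q x = r})"
    by (subst card_eq_sum) (auto simp: of_bool_def sum.If_cases Int_def intro!: arg_cong[of _ _ card])
  finally have "CARD('k) * int (represents UNIV r) =
      CARD('k) * (CARD('k) ^ (2 * m) + excess ?W * (int (card {t. t\<^sup>2 * Q x = r}) - 1))"
    unfolding cW by (simp add: algebra_simps)
  then show ?thesis using card_field_gt_1 by simp
qed

lemma four_neq_0: "(4::'k) \<noteq> 0"
proof -
  have "(2::'k) * 2 \<noteq> 0" using no_zero_divisors[OF two_neq_0 two_neq_0] .
  then show ?thesis by simp
qed

lemma card_square_roots:
  fixes a :: 'k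
  assumes "a \<noteq> 0"
  shows "card {t. t\<^sup>2 * a = a} = 2"
proof -
  have "{t. t\<^sup>2 * a = a} = {1, - 1}" using assms by (auto simp: power2_eq_1_iff)
  moreover have "(1::'k) \<noteq> - 1" using two_neq_0 by (metis add.right_inverse one_add_one)
  ultimately show ?thesis by simp
qed

text \<open>The vectors of norm \<open>Q y\<close> are counted by splitting off \<open>x\<close> and
  by splitting off \<open>y\<close>. In different square classes the equation for \<open>t\<close>
  has no solution for \<open>x\<close> but two for \<open>y\<close>, so the two excesses would be
  opposite.\<close>

lemma same_square_class:
  assumes nd: "nondegenerate UNIV" and c: "card (UNIV :: 'v set) = CARD('k) ^ (2 * m + 1)"
    and x: "Q x \<noteq> 0" and y: "Q y \<noteq> 0"
    and sgn: "excess {v. B x v = 0} * excess {v. B y v = 0} > 0"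
  obtains t where "t\<^sup>2 * Q x = Q y"
proof (cases "\<exists>t. t\<^sup>2 * Q x = Q y")
  case False
  then have "{t. t\<^sup>2 * Q x = Q y} = {}" by simp
  then have "int (represents UNIV (Q y)) = CARD('k) ^ (2 * m) - excess {v. B x v = 0}"
    using represents_UNIV[OF nd c x, of "Q y"] by simp
  moreover have "int (represents UNIV (Q y)) = CARD('k) ^ (2 * m) + excess {v. B y v = 0}"
    using represents_UNIV[OF nd c y, of "Q y"] card_square_roots[OF y] by simp
  ultimately have "excess {v. B x v = 0} = - excess {v. B y v = 0}" by linarith
  then have "excess {v. B x v = 0} * excess {v. B y v = 0} \<le> 0" by simp
  then show thesis using sgn by simp
qed (use that in blast)

section \<open>Isometries\<close>

definition isometry :: "('v \<Rightarrow> 'v) \<Rightarrow> bool" where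
  "isometry g \<longleftrightarrow> bij g \<and> (\<forall>u v. g (u + v) = g u + g v) \<and> (\<forall>a v. g (a *s v) = a *s g v) \<and> (\<forall>v. Q (g v) = Q v)"

lemma isometryD:
  assumes "isometry g"
  shows "bij g" "g (u + v) = g u + g v" "g (a *s v) = a *s g v" "Q (g v) = Q v" "B (g u) (g v) = B u v"
proof -
  show "bij g" and add: "g (u + v) = g u + g v" and "g (a *s v) = a *s g v" "Q (g v) = Q v"
    using assms by (auto simp: isometry_def)
  have "Q (g w) = Q w" for w using assms by (auto simp: isometry_def)
  then show "B (g u) (g v) = B u v" by (simp add: polar_def add[symmetric])
qed

lemma isometry_inv:
  assumes "isometry g"
  shows "isometry (inv g)"
proof -
  note g = isometryD[OF assms]
  have s: "g (inv g v) = v" for v using g(1) by (simp add: bij_is_surj surj_f_inv_f)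
  have i: "inv g w = u" if "w = g u" for u w using g(1) that by (simp add: bij_is_inj)
  have "Q (inv g v) = Q v" for v using g(4)[of "inv g v"] by (simp add: s)
  then show ?thesis
    unfolding isometry_def using bij_imp_bij_inv[OF g(1)] by (auto intro!: i simp: g(2,3) s)
qed

lemma isometry_compose: "isometry g \<Longrightarrow> isometry h \<Longrightarrow> isometry (g \<circ> h)"
  by (auto simp: isometry_def bij_comp)

lemma isometry_uminus: "isometry uminus"
proof -
  have "bij (uminus :: 'v \<Rightarrow> 'v)" by (rule involuntory_imp_bij) simp
  then show ?thesis by (simp add: isometry_def)
qed

text \<open>The coefficient carries no factor 2 because \<open>B a a = 2 * Q a\<close>.\<close>

definition reflection :: "'v \<Rightarrow> 'v \<Rightarrow> 'v" where
  "reflection a v = v - (B a v / Q a) *s a"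

lemma isometry_reflection:
  assumes "Q a \<noteq> 0"
  shows "isometry (reflection a)"
proof -
  have "B a (reflection a v) = - B a v" for v
    using assms by (simp add: reflection_def Q_expand)
  then have "reflection a (reflection a v) = v" for v
    by (simp add: reflection_def)
  then have "bij (reflection a)" by (rule involuntory_imp_bij)
  moreover have "reflection a (u + v) = reflection a u + reflection a v" for u v
    by (simp add: reflection_def polar_linear add_divide_distrib scale_left_distrib)
  moreover have "reflection a (c *s v) = c *s reflection a v" for c v
    by (simp add: reflection_def polar_linear scale_right_diff_distrib)
  moreover have "Q (reflection a v) = Q v" for v
    using assms by (simp add: reflection_def Q_expand polar_commute[of v a] power2_eq_square field_simps)
  ultimately show ?thesis by (simp add: isometry_def)
qed

lemma reflection_swap:
  assumes "Q x = Q y" "Q (x - y) \<noteq> 0"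
  shows "reflection (x - y) x = y"
proof -
  have "B (x - y) x = Q (x - y)"
    using assms(1) by (simp add: Q_expand polar_commute[of y x])
  then show ?thesis using assms(2) by (simp add: reflection_def)
qed

lemma reflection_fix: "B a x = 0 \<Longrightarrow> reflection a x = x"
  by (simp add: reflection_def)

text \<open>The norms of \<open>x - y\<close> and \<open>x + y\<close> add up to
  \<open>4 * Q x\<close>, so one of them is nonzero. A reflection takes \<open>x\<close> to
  \<open>y\<close>, or to \<open>- y\<close>, and then a change of sign finishes.\<close>

lemma isometry_transitive:
  assumes "Q x = Q y" "Q x \<noteq> 0"
  obtains g where "isometry g" "g x = y"
proof (cases "Q (x - y) = 0")
  case False
  then show thesis using that isometry_reflection reflection_swap assms(1) by blast
next
  case True
  have "Q (x - - y) + Q (x - y) = (2 * 2) * Q x" using assms(1) by (simp add: Q_expand)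
  then have "Q (x - - y) \<noteq> 0" using True four_neq_0 assms(2) by simp
  then have "isometry (uminus \<circ> reflection (x - - y))" "(uminus \<circ> reflection (x - - y)) x = y"
    using isometry_compose[OF isometry_uminus isometry_reflection] reflection_swap[of x "- y"] assms(1) by auto
  then show thesis by (rule that)
qed

text \<open>If \<open>y - y'\<close> is singular, two reflections are needed, through a vector \<open>z\<close> for which neither
  \<open>y - z\<close> nor \<open>z - y'\<close> is singular.\<close>

lemma isometry_transitive_tangent:
  assumes nd: "nondegenerate UNIV" and Q: "Q y = Q x" "Q y' = Q x" "Q x \<noteq> 0"
    and B: "B x y = 2 * Q x" "B x y' = 2 * Q x" and ne: "x \<noteq> y" "x \<noteq> y'"
  obtains g where "isometry g" "g x = x" "g y = y'"
proof (cases "Q (y - y') = 0")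
  case False
  have "B (y - y') x = 0" using B by (simp add: polar_linear polar_commute[of _ x])
  then show thesis
    using that[OF isometry_reflection[OF False]] reflection_fix reflection_swap[of y y'] False Q by simp
next
  case True
  \<comment> \<open>Subtracting \<open>x\<close> from \<open>y\<close> and \<open>y'\<close> gives
    nonzero singular vectors orthogonal to \<open>x\<close>; in the present case they are also
    orthogonal to each other.\<close>
  define n n' where "n = y - x" and "n' = y' - x"
  have n: "Q n = 0" "B x n = 0" "n \<noteq> 0" "Q n' = 0" "B x n' = 0" "n' \<noteq> 0"
    using Q B ne by (auto simp: n_def n'_def Q_expand polar_commute[of _ x])
  have "y - y' = n - n'" by (simp add: n_def n'_def)
  then have nn': "B n n' = 0" "B n' n = 0" using True n by (simp_all add: Q_diff polar_commute[of n' n])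
  have ex: "\<exists>v. B x v = 0 \<and> B p v \<noteq> 0" if "p \<noteq> 0" "B x p = 0" for p
    using nondegenerate_polar_UNIV[OF nd Q(3)] that by (auto simp: nondegenerate_def)
  obtain v1 where v1: "B x v1 = 0" "B n v1 \<noteq> 0" using ex[of n] n by blast
  obtain v2 where v2: "B x v2 = 0" "B n' v2 \<noteq> 0" using ex[of n'] n by blast
  \<comment> \<open>The orthogonal space of \<open>x\<close> is not the union of two proper
    subspaces.\<close>
  have "\<exists>v. B x v = 0 \<and> B n v \<noteq> 0 \<and> B n' v \<noteq> 0"
  proof (cases "B n' v1 \<noteq> 0 \<or> B n v2 \<noteq> 0")
    case False
    then show ?thesis using v1 v2 by (intro exI[of _ "v1 + v2"]) (simp add: polar_linear)
  qed (use v1 v2 in blast)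
  then obtain v where v: "B x v = 0" "B n v \<noteq> 0" "B n' v \<noteq> 0" by blast
  \<comment> \<open>The multiple of \<open>n\<close> makes the vector added to \<open>x\<close>
    singular, so \<open>z\<close> has the norm of \<open>x\<close> and
    \<open>B x z = 2 * Q x\<close>. It does not affect the nonzero products with \<open>n\<close>
    and \<open>n'\<close>, which give \<open>Q (y - z)\<close> and \<open>Q (z - y')\<close>
    nonzero.\<close>
  define z where "z = x + (v - (Q v / B n v) *s n)"
  have z: "Q z = Q x" "B x z = 2 * Q x"
    using v n by (simp_all add: z_def Q_expand polar_commute[of v n])
  have B': "B y z \<noteq> 2 * Q x" "B y' z \<noteq> 2 * Q x"
  proof -
    have "y = x + n" "y' = x + n'" by (simp_all add: n_def n'_def)
    then show "B y z \<noteq> 2 * Q x" "B y' z \<noteq> 2 * Q x"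
      using v n nn' by (simp_all add: z_def Q_expand polar_commute[of _ x])
  qed
  have 1: "Q (y - z) \<noteq> 0" "Q (z - y') \<noteq> 0"
    using B' z Q by (auto simp: Q_diff polar_commute[of z y'])
  have 2: "B (y - z) x = 0" "B (z - y') x = 0" using B z by (simp_all add: polar_linear polar_commute[of _ x])
  let ?g = "reflection (z - y') \<circ> reflection (y - z)"
  have "isometry ?g" using isometry_compose isometry_reflection 1 by blast
  moreover have "?g x = x" "?g y = y'" using 1 2 z Q reflection_fix reflection_swap by auto
  ultimately show thesis by (rule that)
qed

section \<open>Isometries preserve types of points\<close>

lemma isometry_subspace: "isometry g \<Longrightarrow> subspace W \<Longrightarrow> subspace (g ` W)"
  using isometryD[of g] subspace_0[of W] isometryD(3)[of g 0 0]
  by (auto simp: subspace_def image_iff) metis+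

lemma isometry_dim:
  assumes "isometry g" "subspace W"
  shows "dim (g ` W) = dim W"
proof -
  have "card (g ` W) = card W"
    using isometryD(1)[OF assms(1)] by (intro card_image) (auto simp: bij_def intro: inj_on_subset)
  then show ?thesis
    using card_subspace[OF assms(2)] card_subspace[OF isometry_subspace[OF assms]] card_field_gt_1
    by (metis power_inject_exp)
qed

lemma isometry_totally_singular: "isometry g \<Longrightarrow> totally_singular W \<Longrightarrow> totally_singular (g ` W)"
  by (auto simp: totally_singular_def isometry_subspace isometryD(4))

lemma isometry_nondegenerate: "isometry g \<Longrightarrow> nondegenerate W \<Longrightarrow> nondegenerate (g ` W)"
  using isometryD(3)[of g 0 0] by (auto simp: nondegenerate_def isometryD(5))

lemma isometry_witt_index:
  assumes "isometry g" "subspace W"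
  shows "witt_index (g ` W) = witt_index W"
proof -
  have le: "{dim L | L. L \<subseteq> W \<and> totally_singular L} \<subseteq> {dim L | L. L \<subseteq> g ` W \<and> totally_singular L}"
    if "isometry g" for g W
  proof clarify
    fix L assume L: "L \<subseteq> W" "totally_singular L"
    then have "dim L = dim (g ` L)" using isometry_dim[OF that] by (simp add: totally_singular_def)
    then show "\<exists>L'. dim L = dim L' \<and> L' \<subseteq> g ` W \<and> totally_singular L'"
      using L isometry_totally_singular[OF that] by blast
  qed
  have "inv g ` g ` W = W" using isometryD(1)[OF assms(1)] by (simp add: bij_is_inj image_inv_f_f)
  then have "{dim L | L. L \<subseteq> W \<and> totally_singular L} = {dim L | L. L \<subseteq> g ` W \<and> totally_singular L}"
    using le[OF assms(1), of W] le[OF isometry_inv[OF assms(1)], of "g ` W"] by simp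
  then show ?thesis by (simp add: witt_index_def)
qed

lemma isometry_hyperbolic: "isometry g \<Longrightarrow> hyperbolic W \<Longrightarrow> hyperbolic (g ` W)"
  by (auto simp: hyperbolic_def isometry_subspace isometry_nondegenerate isometry_dim isometry_witt_index)

lemma isometry_elliptic: "isometry g \<Longrightarrow> elliptic W \<Longrightarrow> elliptic (g ` W)"
  by (auto simp: elliptic_def isometry_subspace isometry_nondegenerate isometry_dim isometry_witt_index)

lemma isometry_perp:
  assumes "isometry g"
  shows "perp (g ` U) = g ` perp U"
proof -
  note g = isometryD[OF assms]
  have "w \<in> perp (g ` U) \<longleftrightarrow> w \<in> g ` perp U" for w
  proof -
    obtain v where "w = g v" using g(1) by (metis bij_pointE)
    moreover have "g v \<in> g ` perp U \<longleftrightarrow> v \<in> perp U" using g(1) by (auto simp: bij_def dest: injD)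
    ultimately show ?thesis by (simp add: perp_def g(5))
  qed
  then show ?thesis by blast
qed

lemma isometry_has_type: "isometry g \<Longrightarrow> has_type p \<epsilon> \<Longrightarrow> has_type (g ` p) \<epsilon>"
  by (auto simp: has_type_def isometry_perp isometry_hyperbolic isometry_elliptic)

lemma isometry_span_singleton: "isometry g \<Longrightarrow> g ` span {x} = span {g x}"
  by (force simp: span_singleton isometryD(3))

lemma perp_span_singleton: "perp (span {x}) = {v. B x v = 0}"
  by (auto simp: perp_def span_singleton polar_linear intro: allE[of _ 1])


section \<open>Points and tangent lines\<close>

lemma span_scale_singleton: "k \<noteq> 0 \<Longrightarrow> span {k *s v} = span {v}"
proof -
  assume k: "k \<noteq> 0"
  have "span {k *s v} \<subseteq> span {v}" by (rule span_minimal) (auto simp: span_scale span_base)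
  moreover have "v = (1 / k) *s (k *s v)" using k by simp
  then have "v \<in> span {k *s v}" by (metis span_scale span_base singletonI)
  then have "span {v} \<subseteq> span {k *s v}" by (intro span_minimal) auto
  ultimately show ?thesis by simp
qed

lemma span_eq_singletonD:
  assumes "span {v} = span {w}"
  obtains k where "v = k *s w"
  using assms span_base[of v "{v}"] by (auto simp: span_singleton)

lemma proj_points_eq: "proj_points = {span {v} | v. v \<noteq> 0}"
proof (intro equalityI subsetI)
  fix p assume "p \<in> proj_points"
  then have p: "subspace p" "dim p = 1" by (auto simp: proj_points_def)
  obtain S where S: "S \<subseteq> p" "independent S" "p \<subseteq> span S" "card S = dim p" by (rule basis_exists)
  then obtain v where "S = {v}" using p by (auto simp: card_1_singleton_iff)
  moreover have "v \<noteq> 0" using S(2) \<open>S = {v}\<close> dependent_zero by auto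
  moreover have "p = span S" using S p by (metis span_minimal subset_antisym)
  ultimately show "p \<in> {span {v} | v. v \<noteq> 0}" by auto
next
  fix p assume "p \<in> {span {v} | v. v \<noteq> 0}"
  then obtain v where v: "p = span {v}" "v \<noteq> 0" by auto
  have "independent {v}" using v(2) by (simp add: independent_insert)
  then have "dim (span {v}) = 1" using dim_span_eq_card_independent by fastforce
  then show "p \<in> proj_points" by (simp add: v proj_points_def)
qed

lemma singular_points_eq: "singular_points = {span {v} | v. v \<noteq> 0 \<and> Q v = 0}"
proof -
  have "(\<forall>u\<in>span {v}. Q u = 0) \<longleftrightarrow> Q v = 0" for v
  proof
    show "Q v = 0" if "\<forall>u\<in>span {v}. Q u = 0" using that span_base[of v "{v}"] by blast
  qed (auto simp: span_singleton Q_scale)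
  then show ?thesis unfolding singular_points_def proj_points_eq by blast
qed

lemma nonsingular_points_eq: "nonsingular_points = {span {v} | v. Q v \<noteq> 0}"
proof (intro equalityI subsetI)
  fix p assume p: "p \<in> nonsingular_points"
  then obtain v where v: "p = span {v}" "v \<noteq> 0" by (auto simp: nonsingular_points_def proj_points_eq)
  then have "Q v \<noteq> 0" using p by (auto simp: nonsingular_points_def singular_points_eq)
  then show "p \<in> {span {v} | v. Q v \<noteq> 0}" using v by auto
next
  fix p assume "p \<in> {span {v} | v. Q v \<noteq> 0}"
  then obtain v where v: "p = span {v}" "Q v \<noteq> 0" by auto
  then have "v \<noteq> 0" by auto
  then have "p \<in> proj_points" using v by (auto simp: proj_points_eq)
  moreover have "p \<notin> singular_points" using v by (auto simp: singular_points_def intro: span_base)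
  ultimately show "p \<in> nonsingular_points" by (simp add: nonsingular_points_def)
qed

lemma span_Un_points: "span (span {x} \<union> span {y}) = span {x, y}"
proof (rule antisym)
  show "span (span {x} \<union> span {y}) \<subseteq> span {x, y}"
    by (intro span_minimal Un_least span_mono) auto
  show "span {x, y} \<subseteq> span (span {x} \<union> span {y})"
    by (rule span_mono) (auto intro: span_base)
qed

lemma span_pair: "v \<in> span {x, y} \<longleftrightarrow> (\<exists>a b. v = a *s x + b *s y)"
proof -
  have "v - a *s x \<in> span {y} \<longleftrightarrow> (\<exists>b. v = a *s x + b *s y)" for a
    by (simp add: span_singleton image_iff diff_eq_eq add.commute)
  then show ?thesis by (simp add: span_insert[of x])
qed

text \<open>As \<open>x\<close> and \<open>y\<close> have equal norm, exchanging the coordinates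
  \<open>a, b\<close> preserves \<open>Q\<close> on the line. A unique singular point is fixed by
  the exchange, so its coordinates are equal or opposite, which determines \<open>B x y\<close>.
  Conversely, \<open>B x y = \<sigma> * (2 * Q x)\<close> makes \<open>Q\<close> on the line a
  multiple of \<open>(a + \<sigma> * b)\<^sup>2\<close>, with a single zero.\<close>

lemma tangent_iff:
  assumes Q: "Q x = Q y" "Q x \<noteq> 0" and ne: "y \<noteq> x" "y \<noteq> - x"
  shows "tangent (span {x, y}) \<longleftrightarrow> B x y = 2 * Q x \<or> B x y = - (2 * Q x)"
proof -
  have x0: "x \<noteq> 0" using Q by auto
  have y: "y \<notin> span {x}"
  proof
    assume "y \<in> span {x}"
    then obtain k where k: "y = k *s x" by (auto simp: span_singleton)
    then have "k\<^sup>2 = 1" using Q by (simp add: Q_scale)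
    then show False using ne k by (auto simp: power2_eq_1_iff)
  qed
  have ind: "a = 0 \<and> b = 0" if "a *s x + b *s y = 0" for a b
  proof -
    have "b = 0"
    proof (rule ccontr)
      assume "b \<noteq> 0"
      have "b *s y = (- a) *s x" using that by (simp add: eq_neg_iff_add_eq_0 add.commute)
      then have "b *s y \<in> span {x}" by (metis span_scale span_base singletonI)
      then have "(1 / b) *s (b *s y) \<in> span {x}" by (rule span_scale)
      then show False using y \<open>b \<noteq> 0\<close> by simp
    qed
    then show ?thesis using that x0 by simp
  qed
  have "independent {y, x}" using x0 y by (simp add: independent_insert)
  moreover have "card {y, x} = 2" using ne by simp
  ultimately have "dim (span {x, y}) = 2" using dim_span_eq_card_independent[of "{y, x}"] by (simp add: insert_commute)
  then have line: "span {x, y} \<in> proj_lines" by (simp add: proj_lines_def)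
  have Qab: "Q (a *s x + b *s y) = (a\<^sup>2 + b\<^sup>2) * Q x + a * b * B x y" for a b
    using Q by (simp add: Q_add Q_scale polar_scale_left polar_scale_right algebra_simps)
  show ?thesis
  proof
    assume "tangent (span {x, y})"
    then obtain p where p: "p \<in> singular_points" "p \<subseteq> span {x, y}"
      and uniq: "\<And>p'. p' \<in> singular_points \<Longrightarrow> p' \<subseteq> span {x, y} \<Longrightarrow> p' = p"
      unfolding tangent_def by blast
    obtain v where v: "p = span {v}" "v \<noteq> 0" "Q v = 0" using p by (auto simp: singular_points_eq)
    then have "v \<in> span {x, y}" using p(2) span_base[of v "{v}"] by auto
    then obtain a b where ab: "v = a *s x + b *s y" unfolding span_pair by blast
    let ?w = "b *s x + a *s y"
    have "Q ?w = Q v" unfolding ab Qab by (simp add: algebra_simps)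
    moreover have "?w \<noteq> 0" using ind[of b a] v(2) ab by auto
    ultimately have "span {?w} \<in> singular_points" using v by (auto simp: singular_points_eq)
    moreover have "?w \<in> span {x, y}" unfolding span_pair by blast
    then have "span {?w} \<subseteq> span {x, y}" by (intro span_minimal) auto
    ultimately have "span {?w} = span {v}" using uniq v by blast
    then obtain k where "?w = k *s v" by (rule span_eq_singletonD)
    then have "(b - k * a) *s x + (a - k * b) *s y = 0"
      by (simp add: ab scale_left_diff_distrib scale_right_distrib algebra_simps)
    then have k: "b = k * a" "a = k * b" using ind by fastforce+
    have "a \<noteq> 0" using k ab v(2) by auto
    moreover have "a = k\<^sup>2 * a" using k by (simp add: power2_eq_square)
    ultimately have "k\<^sup>2 = 1" by simp
    then have "b\<^sup>2 = a\<^sup>2" using k by (simp add: power_mult_distrib)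
    have "a\<^sup>2 * (2 * Q x + k * B x y) = (a\<^sup>2 + a\<^sup>2) * Q x + a * (k * a) * B x y"
      by (simp add: algebra_simps power2_eq_square)
    also have "\<dots> = (a\<^sup>2 + b\<^sup>2) * Q x + a * b * B x y"
      by (simp only: \<open>b\<^sup>2 = a\<^sup>2\<close> k(1)[symmetric])
    also have "\<dots> = 0" using v(3) unfolding ab Qab .
    finally have "a\<^sup>2 * (2 * Q x + k * B x y) = 0" .
    then have "2 * Q x + k * B x y = 0" using \<open>a \<noteq> 0\<close> by simp
    then show "B x y = 2 * Q x \<or> B x y = - (2 * Q x)" using \<open>k\<^sup>2 = 1\<close>
      by (auto simp: power2_eq_1_iff add_eq_0_iff)
  next
    assume "B x y = 2 * Q x \<or> B x y = - (2 * Q x)"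
    then obtain \<sigma> where \<sigma>: "\<sigma>\<^sup>2 = 1" "B x y = \<sigma> * (2 * Q x)"
      by (elim disjE) (auto intro: that[of 1] that[of "- 1"])
    let ?v = "1 *s x + (- \<sigma>) *s y"
    have v: "?v \<noteq> 0" using ind[of 1 "- \<sigma>"] by auto
    have "Q ?v = 0" unfolding Qab using \<sigma> by (simp add: power2_eq_square)
    then have "span {?v} \<in> singular_points" using v unfolding singular_points_eq by blast
    moreover have "?v \<in> span {x, y}" unfolding span_pair by blast
    then have "span {?v} \<subseteq> span {x, y}" by (intro span_minimal) auto
    moreover have "p = span {?v}" if p: "p \<in> singular_points" "p \<subseteq> span {x, y}" for p
    proof -
      obtain w where w: "p = span {w}" "w \<noteq> 0" "Q w = 0" using p by (auto simp: singular_points_eq)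
      then have "w \<in> span {x, y}" using p(2) span_base[of w "{w}"] by auto
      then obtain a b where ab: "w = a *s x + b *s y" unfolding span_pair by blast
      have "(a + \<sigma> * b)\<^sup>2 * Q x = (a\<^sup>2 + \<sigma>\<^sup>2 * b\<^sup>2) * Q x + a * b * (\<sigma> * (2 * Q x))"
        by (simp add: algebra_simps power2_eq_square)
      also have "\<dots> = 0" using w(3) unfolding ab Qab \<sigma> by simp
      finally have a: "a = - (\<sigma> * b)" using Q by (simp add: add_eq_0_iff)
      have "b = - \<sigma> * a" unfolding a using \<sigma>(1) by (simp add: power2_eq_square mult.assoc[symmetric])
      then have "w = a *s ?v" unfolding ab by (simp add: scale_right_diff_distrib mult.commute)
      moreover have "a \<noteq> 0" using calculation w(2) by auto
      ultimately show ?thesis using w(1) span_scale_singleton by simp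
    qed
    ultimately show "tangent (span {x, y})" unfolding tangent_def using line by blast
  qed
qed

lemma has_type_excess: "has_type (span {x}) \<epsilon> \<Longrightarrow> \<epsilon> * excess {v. B x v = 0} > 0"
  using excess_hyperbolic[of "{v. B x v = 0}"] excess_elliptic[of "{v. B x v = 0}"]
  by (auto simp: has_type_def perp_span_singleton)

text \<open>Equal signs of the excess put all vertices in the square class of \<open>Q x\<close>, so
  each has a generator of norm \<open>Q x\<close>. Conversely, an isometry taking \<open>x\<close>
  to a vector of this norm transports the type.\<close>

lemma NO_verts_eq:
  assumes nd: "nondegenerate UNIV" and c: "card (UNIV :: 'v set) = CARD('k) ^ (2 * m + 1)"
    and x: "Q x \<noteq> 0" "has_type (span {x}) \<epsilon>"
  shows "NO_verts \<epsilon> = (\<lambda>v. span {v}) ` {v. Q v = Q x}"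
proof (intro equalityI subsetI)
  fix p assume "p \<in> NO_verts \<epsilon>"
  then obtain v where v: "p = span {v}" "Q v \<noteq> 0" "has_type (span {v}) \<epsilon>"
    by (auto simp: NO_verts_def nonsingular_points_eq)
  have "\<epsilon> = 1 \<or> \<epsilon> = - 1" using x(2) by (auto simp: has_type_def)
  then have "excess {w. B v w = 0} * excess {w. B x w = 0} > 0"
    using has_type_excess[OF v(3)] has_type_excess[OF x(2)] by (auto simp: zero_less_mult_iff)
  then obtain t where t: "t\<^sup>2 * Q v = Q x" using same_square_class[OF nd c v(2) x(1)] by blast
  then have "t \<noteq> 0" using x(1) by auto
  then have "p = span {t *s v}" using v(1) span_scale_singleton by simp
  then show "p \<in> (\<lambda>v. span {v}) ` {v. Q v = Q x}" using t by (intro image_eqI[of _ _ "t *s v"]) (auto simp: Q_scale)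
next
  fix p assume "p \<in> (\<lambda>v. span {v}) ` {v. Q v = Q x}"
  then obtain v where v: "p = span {v}" "Q v = Q x" by auto
  obtain g where g: "isometry g" "g x = v" using isometry_transitive[of x v] v x by auto
  have "has_type p \<epsilon>"
    using isometry_has_type[OF g(1) x(2)] isometry_span_singleton[OF g(1), of x] g(2) v(1) by simp
  moreover have "p \<in> nonsingular_points" using v x by (auto simp: nonsingular_points_eq)
  ultimately show "p \<in> NO_verts \<epsilon>" by (simp add: NO_verts_def)
qed

end

section \<open>Common neighbours of nonadjacent vertices\<close>

text \<open>The dimension is \<open>2n + 3\<close>, so that \<open>n = m - 1\<close> without truncated subtraction.\<close>

locale odd_nondegenerate_space = odd_quadratic_space scale Q
  for scale :: "'k::{field,finite} \<Rightarrow> 'v::ab_group_add \<Rightarrow> 'v" (infixr \<open>*s\<close> 75)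
    and Q :: "'v \<Rightarrow> 'k" +
  fixes n :: nat and c :: 'k
  assumes nondegenerate_UNIV: "nondegenerate UNIV"
    and card_UNIV: "card (UNIV :: 'v set) = CARD('k) ^ (2 * Suc n + 1)"
    and c_neq_0: "c \<noteq> 0"
begin

text \<open>The common excess of the orthogonal spaces of all vectors of norm \<open>c\<close>,
  written without choosing one: for \<open>r = c\<close> in \<open>represents_UNIV\<close> there are
  two values of \<open>t\<close>, so the excess occurs with factor 1.\<close>

definition E :: int where
  "E = int (represents UNIV c) - CARD('k) ^ (2 * Suc n)"

definition vcommon_pos :: "'v \<Rightarrow> 'v \<Rightarrow> 'v set" where
  "vcommon_pos x y = {z. Q z = c \<and> B x z = 2 * c \<and> B y z = 2 * c}"

lemma excess_polar: "Q x = c \<Longrightarrow> excess {v. B x v = 0} = E"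
  using represents_UNIV[OF nondegenerate_UNIV card_UNIV, of x c] c_neq_0 card_square_roots[of c]
  by (simp add: E_def)

lemma represents_scale:
  assumes "subspace W" "k \<noteq> 0"
  shows "represents W (k\<^sup>2 * r) = represents W r"
  unfolding represents_def
  by (rule bij_betw_same_card[of "\<lambda>v. (1 / k) *s v"], rule bij_betw_byWitness[of _ "\<lambda>v. k *s v"])
    (use assms in \<open>auto simp: Q_scale subspace_scale power_divide\<close>)

end

section \<open>Counting with fixed signs for a nontangent pair\<close>

locale nontangent_pair = odd_nondegenerate_space scale Q n c
  for scale :: "'k::{field,finite} \<Rightarrow> 'v::ab_group_add \<Rightarrow> 'v" (infixr \<open>*s\<close> 75)
    and Q :: "'v \<Rightarrow> 'k" and n c +
  fixes x y :: 'v
  assumes Qx: "Q x = c" and Qy: "Q y = c" and nontangent: "B x y \<noteq> 2 * c" "B x y \<noteq> - 2 * c"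
begin

abbreviation b :: 'k where
  "b \<equiv> B x y"

text \<open>For \<open>z\<close> in \<open>vcommon_pos x y\<close>, the orthogonal projection to the span of \<open>x\<close> and \<open>y\<close> is
  \<open>\<alpha>(x + y)\<close>, and \<open>s\<close> is the value of \<open>Q\<close> at the component in \<open>U\<close>.\<close>

definition \<kappa> :: 'k where
  "\<kappa> = b / (2 * c)"

definition \<alpha> :: 'k where
  "\<alpha> = 1 / (\<kappa> + 1)"

definition s :: 'k where
  "s = c * (\<kappa> - 1) / (\<kappa> + 1)"

definition U :: "'v set" where
  "U = {v. B x v = 0 \<and> B y v = 0}"

lemma b_eq: "b = 2 * c * \<kappa>"
  using c_neq_0 two_neq_0 by (simp add: \<kappa>_def)

lemma nz: "\<kappa> + 1 \<noteq> 0" "\<kappa> - 1 \<noteq> 0" "s \<noteq> 0"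
proof -
  show "\<kappa> + 1 \<noteq> 0" "\<kappa> - 1 \<noteq> 0" using nontangent unfolding b_eq by (auto simp: eq_neg_iff_add_eq_0[symmetric])
  then show "s \<noteq> 0" using c_neq_0 by (simp add: s_def)
qed

text \<open>As \<open>B x (x + y) = b + 2 * c\<close>, this is the requirement that
  \<open>\<alpha> *s (x + y)\<close> have product \<open>2 * c\<close> with \<open>x\<close>, and by
  symmetry with \<open>y\<close>.\<close>

lemma alpha: "\<alpha> * (b + 2 * c) = 2 * c"
proof -
  have "b + 2 * c = 2 * c * (\<kappa> + 1)" unfolding b_eq by (simp add: algebra_simps)
  then show ?thesis using nz by (simp add: \<alpha>_def)
qed

text \<open>The norm of \<open>\<alpha> *s (x + y)\<close> is
  \<open>\<alpha>\<^sup>2 * (b + 2 * c) = 2 * c * \<alpha>\<close>; the component in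
  \<open>U\<close> has the rest of the norm \<open>c\<close>.\<close>

lemma s_alpha: "s = c - 2 * c * \<alpha>"
  using nz by (simp add: s_def \<alpha>_def field_simps)

text \<open>\<open>U\<close> is the complement of \<open>y - \<kappa> *s x\<close>, the projection
  of \<open>y\<close>, in the orthogonal space of \<open>x\<close>. Its norm
  \<open>c * (1 - \<kappa>\<^sup>2)\<close> is nonzero exactly because the pair is not
  tangent.\<close>

lemma polar_U:
  shows "subspace U" "nondegenerate U" "card U = CARD('k) ^ Suc (2 * n)"
    "represents {v. B x v = 0} r = (\<Sum>t\<in>UNIV. represents U (r - t\<^sup>2 * (c * (1 - \<kappa>\<^sup>2))))"
proof -
  let ?P = "{v. B x v = 0}" and ?y = "y - \<kappa> *s x"
  have Qx0: "Q x \<noteq> 0" using Qx c_neq_0 by simp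
  have P: "subspace ?P" "nondegenerate ?P" "card ?P = CARD('k) ^ (2 * Suc n)"
    using subspace_polar_UNIV nondegenerate_polar_UNIV[OF nondegenerate_UNIV Qx0] card_polar_UNIV[OF Qx0]
      card_UNIV card_field_gt_1 by auto
  have Qy': "Q ?y = c * (1 - \<kappa>\<^sup>2)"
    using Qx Qy by (simp add: Q_diff Q_scale polar_scale_right polar_commute[of y x] b_eq algebra_simps power2_eq_square)
  have "1 - \<kappa>\<^sup>2 = - ((\<kappa> + 1) * (\<kappa> - 1))" by (simp add: algebra_simps power2_eq_square)
  then have y0: "Q ?y \<noteq> 0" unfolding Qy' using nz c_neq_0 by simp
  have yP: "?y \<in> ?P" using Qx by (simp add: polar_linear polar_self b_eq)
  have U: "{v \<in> ?P. B ?y v = 0} = U" by (auto simp: U_def polar_linear)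
  show "subspace U" "nondegenerate U"
    using subspace_polar[OF P(1), of ?y] nondegenerate_polar[OF P(1,2) yP y0] unfolding U .
  show "card U = CARD('k) ^ Suc (2 * n)"
    using card_split[OF P(1) yP y0] P(3) card_field_gt_1 unfolding U by simp
  show "represents ?P r = (\<Sum>t\<in>UNIV. represents U (r - t\<^sup>2 * (c * (1 - \<kappa>\<^sup>2))))"
    using represents_split[OF P(1) yP y0] unfolding U Qy' .
qed

lemma vcommon_pos_projection:
  assumes "z \<in> vcommon_pos x y"
  shows "z - \<alpha> *s (x + y) \<in> U" "Q (z - \<alpha> *s (x + y)) = s"
proof -
  have z: "Q z = c" "B x z = 2 * c" "B y z = 2 * c" using assms by (auto simp: vcommon_pos_def)
  have "B x (x + y) = b + 2 * c" "B y (x + y) = b + 2 * c" "B z (x + y) = 4 * c" "Q (x + y) = b + 2 * c"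
    using Qx Qy z by (simp_all add: Q_expand polar_commute[of y x] polar_commute[of z])
  note * = this
  show "z - \<alpha> *s (x + y) \<in> U"
    unfolding U_def using z alpha by (simp add: polar_diff_right polar_scale_right *)
  have "Q (z - \<alpha> *s (x + y)) = c + \<alpha> * (\<alpha> * (b + 2 * c)) - 4 * c * \<alpha>"
    using z by (simp add: Q_diff Q_scale polar_scale_right * power2_eq_square)
  also have "\<dots> = s" unfolding alpha s_alpha by simp
  finally show "Q (z - \<alpha> *s (x + y)) = s" .
qed

lemma card_vcommon_pos_eq: "card (vcommon_pos x y) = represents U s"
  unfolding represents_def
proof (rule bij_betw_same_card[of "\<lambda>z. z - \<alpha> *s (x + y)"], rule bij_betw_byWitness[of _ "\<lambda>u. u + \<alpha> *s (x + y)"])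
  show "(\<lambda>z. z - \<alpha> *s (x + y)) ` vcommon_pos x y \<subseteq> {v \<in> U. Q v = s}"
    using vcommon_pos_projection by auto
  have "u + \<alpha> *s (x + y) \<in> vcommon_pos x y" if "u \<in> U" "Q u = s" for u
  proof -
    have *: "B x (x + y) = b + 2 * c" "B y (x + y) = b + 2 * c" "B u (x + y) = 0" "Q (x + y) = b + 2 * c"
      using Qx Qy that by (simp_all add: U_def Q_expand polar_commute[of y x] polar_commute[of u])
    have "Q (u + \<alpha> *s (x + y)) = s + \<alpha> * (\<alpha> * (b + 2 * c))"
      using that by (simp add: Q_add[of u] Q_scale polar_scale_right * power2_eq_square)
    also have "\<dots> = c" unfolding alpha s_alpha by simp
    finally show ?thesis using that alpha by (simp add: vcommon_pos_def U_def polar_add_right[of _ u] polar_scale_right *)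
  qed
  then show "(\<lambda>u. u + \<alpha> *s (x + y)) ` {v \<in> U. Q v = s} \<subseteq> vcommon_pos x y" by auto
qed auto

text \<open>Zeros of \<open>Q\<close> on the orthogonal space of \<open>x\<close> are split along
  the projection of \<open>y\<close>. For \<open>t\<close> nonzero the norm needed in
  \<open>U\<close> is \<open>(t * (\<kappa> + 1))\<^sup>2 * s\<close>, in the square class of
  \<open>s\<close>, so q - 1 terms equal the wanted number. The term \<open>t = 0\<close> is known
  from \<open>represents_odd_zero\<close> and the total from \<open>E\<close>.\<close>

lemma card_vcommon_pos: "CARD('k) * int (card (vcommon_pos x y)) = CARD('k) ^ Suc (2 * n) + E"
proof -
  let ?P = "{v. B x v = 0}" and ?N = "int (represents U s)" and ?q = "int CARD('k)"
  let ?\<rho> = "c * (1 - \<kappa>\<^sup>2)"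
  have Qx0: "Q x \<noteq> 0" using Qx c_neq_0 by simp
  have P: "subspace ?P" "nondegenerate ?P" "card ?P = CARD('k) ^ (2 * Suc n)"
    using subspace_polar_UNIV nondegenerate_polar_UNIV[OF nondegenerate_UNIV Qx0] card_polar_UNIV[OF Qx0]
      card_UNIV card_field_gt_1 by auto
  have *: "represents U (0 - t\<^sup>2 * ?\<rho>) = represents U s" if "t \<noteq> 0" for t
  proof -
    let ?k = "t * (\<kappa> + 1)"
    have "?k\<^sup>2 * s = 0 - t\<^sup>2 * ?\<rho>"
      using nz(1) by (simp add: s_def field_simps power2_eq_square)
    moreover have "?k \<noteq> 0" using that nz(1) by simp
    ultimately show ?thesis using represents_scale[OF polar_U(1), of ?k s] by simp
  qed
  have "represents ?P 0 = represents U 0 + (CARD('k) - 1) * represents U s"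
    unfolding polar_U(4) by (subst sum_if_const_neq[of 0, OF *]) simp_all
  then have "?q * int (represents ?P 0) = ?q * int (represents U 0) + ?q * ((?q - 1) * ?N)"
    using card_field_gt_1 by (simp add: of_nat_diff distrib_left)
  moreover have "?q * int (represents U 0) = ?q ^ Suc (2 * n)"
    using represents_odd_zero[OF polar_U(1,2,3)] polar_U(3) by (metis of_nat_mult of_nat_power)
  moreover have "?q * int (represents ?P 0) = ?q ^ (2 * Suc n) - E + ?q * E"
    using represents_even_excess[OF P, of 0] excess_polar[OF Qx] P(3) by simp
  ultimately have "(?q - 1) * (?q * ?N) = (?q - 1) * (?q ^ Suc (2 * n) + E)"
    by (simp add: algebra_simps)
  then have "?q * ?N = ?q ^ Suc (2 * n) + E" using card_field_gt_1 by simp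
  then show ?thesis by (simp add: card_vcommon_pos_eq)
qed

text \<open>\<open>W\<close> is the complement in \<open>U\<close> of the projection
  \<open>u\<close> of \<open>z\<close>, whose norm is \<open>s\<close>. Counting vectors of norm
  \<open>s\<close> in \<open>U\<close> through \<open>W\<close> meets the value 0 for
  \<open>t\<close> equal to 1 and -1; comparison with \<open>card_vcommon_pos\<close> shows that q
  times the excess of \<open>W\<close> is \<open>E\<close>.\<close>

lemma represents_polar_triple:
  assumes z: "z \<in> vcommon_pos x y"
  defines "W \<equiv> {w. B x w = 0 \<and> B y w = 0 \<and> B z w = 0}"
  shows "(int CARD('k))\<^sup>2 * int (represents W r) =
    CARD('k) ^ Suc (2 * n) - E + CARD('k) * E * of_bool (r = 0)"
proof -
  let ?q = "int CARD('k)"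
  define u where "u = z - \<alpha> *s (x + y)"
  have u: "u \<in> U" "Q u = s" "Q u \<noteq> 0" using vcommon_pos_projection[OF z] nz by (simp_all add: u_def)
  have W: "W = {w \<in> U. B u w = 0}"
    by (auto simp: W_def U_def u_def polar_linear)
  have sW: "subspace W" "nondegenerate W" and cW: "card W = CARD('k) ^ (2 * n)"
    unfolding W using subspace_polar[OF polar_U(1)] nondegenerate_polar[OF polar_U(1,2) u(1,3)]
      card_split[OF polar_U(1) u(1,3)] polar_U(3) card_field_gt_1 by auto
  note even = represents_even_excess[OF sW cW]
  have roots: "{t. s - t\<^sup>2 * s = 0} = {t. t\<^sup>2 * s = s}" by auto
  have "?q * int (represents U s) = (\<Sum>t\<in>UNIV. ?q * int (represents W (s - t\<^sup>2 * s)))"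
    using represents_split[OF polar_U(1) u(1,3), of s] unfolding W u(2) by (simp add: sum_distrib_left)
  also have "\<dots> = ?q * (card W - excess W) + ?q * excess W * (\<Sum>t\<in>(UNIV::'k set). of_bool (s - t\<^sup>2 * s = 0))"
    unfolding even by (simp add: sum.distrib sum_distrib_left)
  also have "(\<Sum>t\<in>(UNIV::'k set). of_bool (s - t\<^sup>2 * s = 0)) = int (card {t. s - t\<^sup>2 * s = 0})"
    by (subst card_eq_sum) (auto simp: of_bool_def sum.If_cases Int_def intro!: arg_cong[of _ _ card])
  also have "\<dots> = 2" unfolding roots card_square_roots[OF nz(3)] by simp
  finally have "?q * int (represents U s) = ?q * (?q ^ (2 * n)) + ?q * excess W"
    unfolding cW by (simp add: algebra_simps)
  then have "?q * excess W = E" using card_vcommon_pos card_vcommon_pos_eq by simp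
  note excess = this
  have "?q\<^sup>2 * int (represents W r) = ?q * (?q * int (represents W r))" by (simp add: power2_eq_square)
  also have "\<dots> = ?q * card W - ?q * excess W + ?q * (?q * excess W) * of_bool (r = 0)"
    unfolding even by (simp add: algebra_simps)
  finally show ?thesis unfolding excess cW by simp
qed

text \<open>The prescribed products define a coset of the orthogonal space through \<open>p\<close>.
  The first hypothesis makes \<open>p\<close> orthogonal to that space, so \<open>Q w\<close> is the
  sum of \<open>Q p\<close> and \<open>Q (w - p)\<close>.\<close>

lemma card_prescribed_polar:
  assumes "\<And>w. B x w = 0 \<Longrightarrow> B y w = 0 \<Longrightarrow> B z w = 0 \<Longrightarrow> B p w = 0"
    and p: "B x p = i" "B y p = j" "B z p = k" "c - Q p = r"
  shows "card {w. Q w = c \<and> B x w = i \<and> B y w = j \<and> B z w = k} =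
    represents {w. B x w = 0 \<and> B y w = 0 \<and> B z w = 0} r"
  unfolding represents_def
proof (rule bij_betw_same_card[of "\<lambda>w. w - p"], rule bij_betw_byWitness[of _ "\<lambda>w. w + p"])
  show "(\<lambda>w. w - p) ` {w. Q w = c \<and> B x w = i \<and> B y w = j \<and> B z w = k}
      \<subseteq> {v \<in> {w. B x w = 0 \<and> B y w = 0 \<and> B z w = 0}. Q v = r}"
  proof clarify
    fix w assume w: "c = Q w" "i = B x w" "j = B y w" "k = B z w"
    have "B p (w - p) = 0" by (rule assms(1)) (use w p in \<open>simp_all add: polar_diff_right\<close>)
    then have "B w p = 2 * Q p" by (simp add: polar_diff_right polar_self polar_commute[of w p])
    then show "w - p \<in> {w. B x w = 0 \<and> B y w = 0 \<and> B z w = 0} \<and> Q (w - p) = r"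
      using w p by (auto simp: polar_diff_right Q_diff)
  qed
  show "(\<lambda>w. w + p) ` {v \<in> {w. B x w = 0 \<and> B y w = 0 \<and> B z w = 0}. Q v = r}
      \<subseteq> {w. Q w = c \<and> B x w = i \<and> B y w = j \<and> B z w = k}"
    using assms by (auto simp: polar_add_right Q_add polar_commute[of _ p])
qed auto

text \<open>The signs of \<open>B y w\<close> and \<open>B z w\<close> fix the projection \<open>p\<close> of \<open>w\<close> to the span of \<open>x, y, z\<close>.
  Only for the signs \<open>+, -\<close> the remaining value \<open>c - Q p\<close> is nonzero; that it vanishes for \<open>B y w = -2c\<close>
  reflects that the values \<open>s\<close> for \<open>y\<close> and \<open>-y\<close> have product \<open>c\<^sup>2\<close>.\<close>

lemma card_vcommon_pos_adjacent:
  assumes z: "z \<in> vcommon_pos x y"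
  shows "(int CARD('k))\<^sup>2 * (int (card {w. Q w = c \<and> B x w = 2 * c \<and> (B y w = 2 * c \<or> B y w = - 2 * c) \<and>
      (B z w = 2 * c \<or> B z w = - 2 * c) \<and> w \<noteq> z}) + 1) =
    4 * (CARD('k) ^ Suc (2 * n) - E) + 3 * (CARD('k) * E)" (is "_ * (int (card ?D) + 1) = _")
proof -
  define S where "S j k = {w. Q w = c \<and> B x w = 2 * c \<and> B y w = j \<and> B z w = k}" for j k
  define W where "W = {w. B x w = 0 \<and> B y w = 0 \<and> B z w = 0}"
  define u where "u = z - \<alpha> *s (x + y)"
  \<comment> \<open>For the sign pattern of \<open>x, - y\<close> the projection is a multiple of
    \<open>x - y\<close>, and \<open>B x (x - y) = 2 * c * (1 - \<kappa>)\<close> fixes the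
    multiple.\<close>
  define \<beta> where "\<beta> = 1 / (1 - \<kappa>)"
  have ks: "\<kappa> + 1 \<noteq> 0" "1 - \<kappa> \<noteq> 0" "\<kappa> - 1 \<noteq> 0" using nz by auto
  have Qz: "Q z = c" "B x z = 2 * c" "B y z = 2 * c" "B z x = 2 * c" "B z y = 2 * c"
    using z by (auto simp: vcommon_pos_def polar_commute[of z])
  have u: "B x u = 0" "B y u = 0" "Q u = s" using vcommon_pos_projection[OF z] by (simp_all add: u_def U_def)
  then have ux: "B (x + y) u = 0" "B (x - y) u = 0" by (simp_all add: polar_linear)
  have z_eq: "z = \<alpha> *s (x + y) + u" by (simp add: u_def)
  have zu: "B z u = 2 * s" unfolding z_eq using u ux by (simp add: polar_add_left polar_scale_left polar_self)
  have bx: "B x x = 2 * c" "B y y = 2 * c" "B y x = b" using Qx Qy by (simp_all add: polar_self polar_commute)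
  have Qxy: "Q (x + y) = 2 * c * (\<kappa> + 1)" "Q (x - y) = 2 * c * (1 - \<kappa>)"
    using Qx Qy by (simp_all add: Q_add Q_diff b_eq algebra_simps)
  have polar_p: "B x (a *s (x + y) + k *s u) = a * (2 * c * (1 + \<kappa>))"
    "B y (a *s (x + y) + k *s u) = a * (2 * c * (1 + \<kappa>))"
    "B z (a *s (x + y) + k *s u) = a * (4 * c) + k * (2 * s)"
    "B x (a *s (x - y) + k *s u) = a * (2 * c * (1 - \<kappa>))"
    "B y (a *s (x - y) + k *s u) = - a * (2 * c * (1 - \<kappa>))"
    "B z (a *s (x - y) + k *s u) = k * (2 * s)" for a k
    unfolding polar_add_right polar_diff_right polar_scale_right u bx zu Qz b_eq
    by (simp_all add: algebra_simps)
  have Q_p: "Q (a *s (x + y) + k *s u) = a\<^sup>2 * (2 * c * (\<kappa> + 1)) + k\<^sup>2 * s"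
    "Q (a *s (x - y) + k *s u) = a\<^sup>2 * (2 * c * (1 - \<kappa>)) + k\<^sup>2 * s" for a k
    using u ux by (simp_all add: Q_add[of "_ *s _"] Q_scale polar_scale_left polar_scale_right Qxy)
  have perp_p: "B (a *s (x + y) + k *s u) w = 0" "B (a *s (x - y) + k *s u) w = 0"
    if "B x w = 0" "B y w = 0" "B z w = 0" for a k w
    using that by (simp_all add: polar_add_left polar_diff_left polar_scale_left u_def)
  \<comment> \<open>Here \<open>p\<close> is \<open>z\<close> itself, and nothing of the norm
    \<open>c\<close> is left.\<close>
  have 1: "card (S (2 * c) (2 * c)) = represents W 0"
    unfolding S_def W_def using Qz by (intro card_prescribed_polar[of z z]) (simp_all add: polar_self)
  \<comment> \<open>Solves \<open>4 * c * \<alpha> + 2 * (k * s) = - 2 * c\<close>, the condition on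
    the product with \<open>z\<close>. The remaining norm \<open>s * (1 - k\<^sup>2)\<close> is
    nonzero because \<open>k = 1\<close> would give \<open>2 * c = 0\<close> and
    \<open>k = - 1\<close> would give \<open>4 * c * \<alpha> = 0\<close>.\<close>
  define k where "k = - (c + 2 * c * \<alpha>) / s"
  have ks2: "k * s = - (c + 2 * c * \<alpha>)" using nz by (simp add: k_def)
  have k1: "k \<noteq> 1" "k \<noteq> - 1"
  proof -
    have "k * s - s = - (2 * c)" unfolding ks2 by (simp add: s_alpha algebra_simps)
    then show "k \<noteq> 1" using c_neq_0 two_neq_0 by auto
    have "k * s + s = - (4 * c * \<alpha>)" unfolding ks2 by (simp add: s_alpha algebra_simps)
    then show "k \<noteq> - 1" using c_neq_0 four_neq_0 nz by (auto simp: \<alpha>_def)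
  qed
  have 2: "card (S (2 * c) (- 2 * c)) = represents W (s * (1 - k\<^sup>2))"
    unfolding S_def W_def
  proof (rule card_prescribed_polar[of z "\<alpha> *s (x + y) + k *s u"])
    show "B x (\<alpha> *s (x + y) + k *s u) = 2 * c" "B y (\<alpha> *s (x + y) + k *s u) = 2 * c"
      unfolding polar_p using ks(1) by (simp_all add: \<alpha>_def add.commute)
    have "B z (\<alpha> *s (x + y) + k *s u) = 4 * c * \<alpha> + 2 * (k * s)" unfolding polar_p by (simp add: algebra_simps)
    also have "\<dots> = - 2 * c" unfolding ks2 by (simp add: algebra_simps)
    finally show "B z (\<alpha> *s (x + y) + k *s u) = - 2 * c" .
    have "\<alpha>\<^sup>2 * (2 * c * (\<kappa> + 1)) = c - s" unfolding s_alpha using ks(1) by (simp add: \<alpha>_def power2_eq_square)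
    then show "c - Q (\<alpha> *s (x + y) + k *s u) = s * (1 - k\<^sup>2)" unfolding Q_p by (simp add: algebra_simps)
  qed (rule perp_p)
  have r2: "s * (1 - k\<^sup>2) \<noteq> 0"
  proof -
    have "1 - k\<^sup>2 = (1 - k) * (1 + k)" by (simp add: algebra_simps power2_eq_square)
    then show ?thesis using k1 nz by (auto simp: add_eq_0_iff)
  qed
  \<comment> \<open>Since \<open>B z u = 2 * s\<close>, the coefficient of \<open>u\<close> must be
    \<open>i * c / s\<close>. It contributes the norm \<open>c\<^sup>2 / s\<close> for both signs
    \<open>i\<close>, exactly what the multiple of \<open>x - y\<close> leaves of
    \<open>c\<close>.\<close>
  have 3: "card (S (- 2 * c) (i * (2 * c))) = represents W 0" if "i\<^sup>2 = 1" for i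
    unfolding S_def W_def
  proof (rule card_prescribed_polar[of z "\<beta> *s (x - y) + (i * c / s) *s u"])
    show "B x (\<beta> *s (x - y) + (i * c / s) *s u) = 2 * c" "B y (\<beta> *s (x - y) + (i * c / s) *s u) = - 2 * c"
      "B z (\<beta> *s (x - y) + (i * c / s) *s u) = i * (2 * c)"
      unfolding polar_p using ks nz by (simp_all add: \<beta>_def)
    have "(i * c / s)\<^sup>2 * s = c\<^sup>2 / s" using nz that by (simp add: power2_eq_square field_simps)
    also have "\<dots> = c * (\<kappa> + 1) / (\<kappa> - 1)" using ks c_neq_0 by (simp add: s_def power2_eq_square)
    finally have "(i * c / s)\<^sup>2 * s = c * (\<kappa> + 1) / (\<kappa> - 1)" .
    moreover have "\<beta>\<^sup>2 * (2 * c * (1 - \<kappa>)) = 2 * c / (1 - \<kappa>)" using ks by (simp add: \<beta>_def power2_eq_square)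
    moreover have "2 * c / (1 - \<kappa>) + c * (\<kappa> + 1) / (\<kappa> - 1) = c"
    proof -
      have "2 * c / (1 - \<kappa>) = - (2 * c / (\<kappa> - 1))" using ks by (simp add: field_simps)
      then have "2 * c / (1 - \<kappa>) + c * (\<kappa> + 1) / (\<kappa> - 1) = (c * (\<kappa> + 1) - 2 * c) / (\<kappa> - 1)"
        by (simp add: diff_divide_distrib)
      also have "c * (\<kappa> + 1) - 2 * c = c * (\<kappa> - 1)" by (simp add: algebra_simps)
      finally show ?thesis using ks by simp
    qed
    ultimately show "c - Q (\<beta> *s (x - y) + (i * c / s) *s u) = 0" unfolding Q_p by simp
  qed (rule perp_p)
  have neq: "2 * c \<noteq> - 2 * c"
  proof
    assume "2 * c = - 2 * c"
    then have "4 * c = 0" by (simp add: algebra_simps)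
    then show False using four_neq_0 c_neq_0 by simp
  qed
  have zS: "z \<in> S (2 * c) (2 * c)" using Qz by (simp add: S_def polar_self)
  \<comment> \<open>\<open>z\<close> satisfies the conditions of the first sign class but is not its
    own neighbour; this is the 1 added in the statement.\<close>
  have "insert z ?D = (S (2 * c) (2 * c) \<union> S (2 * c) (- 2 * c)) \<union> (S (- 2 * c) (2 * c) \<union> S (- 2 * c) (- 2 * c))"
    using zS by (auto simp: S_def)
  then have "card (insert z ?D) =
      card ((S (2 * c) (2 * c) \<union> S (2 * c) (- 2 * c)) \<union> (S (- 2 * c) (2 * c) \<union> S (- 2 * c) (- 2 * c)))"
    by (rule arg_cong)
  also have "\<dots> = card (S (2 * c) (2 * c) \<union> S (2 * c) (- 2 * c)) + card (S (- 2 * c) (2 * c) \<union> S (- 2 * c) (- 2 * c))"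
    using neq by (intro card_Un_disjoint) (auto simp: S_def)
  also have "card (S (2 * c) (2 * c) \<union> S (2 * c) (- 2 * c)) = card (S (2 * c) (2 * c)) + card (S (2 * c) (- 2 * c))"
    using neq by (intro card_Un_disjoint) (auto simp: S_def)
  also have "card (S (- 2 * c) (2 * c) \<union> S (- 2 * c) (- 2 * c)) = card (S (- 2 * c) (2 * c)) + card (S (- 2 * c) (- 2 * c))"
    using neq by (intro card_Un_disjoint) (auto simp: S_def)
  also have "card (insert z ?D) = card ?D + 1" by simp
  finally have "int (card ?D) + 1 = 3 * int (represents W 0) + int (represents W (s * (1 - k\<^sup>2)))"
    using 1 2 3[of 1] 3[of "- 1"] by simp
  then have "(int CARD('k))\<^sup>2 * (int (card ?D) + 1) = 3 * ((int CARD('k))\<^sup>2 * int (represents W 0)) +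
      (int CARD('k))\<^sup>2 * int (represents W (s * (1 - k\<^sup>2)))"
    by (simp only:) (simp add: algebra_simps)
  also have "\<dots> = 3 * (CARD('k) ^ Suc (2 * n) - E + CARD('k) * E) + (CARD('k) ^ Suc (2 * n) - E)"
    unfolding W_def represents_polar_triple[OF z] using r2 by simp
  finally show ?thesis by simp
qed

end

section \<open>From signed vectors to vertices of the graph\<close>

context odd_nondegenerate_space
begin

text \<open>Adjacency and common neighbours on the vectors of norm \<open>c\<close>, each vertex being \<open>{v, -v}\<close>.\<close>

definition vadj :: "'v \<Rightarrow> 'v \<Rightarrow> bool" where
  "vadj x y \<longleftrightarrow> y \<noteq> x \<and> y \<noteq> - x \<and> (B x y = 2 * c \<or> B x y = - 2 * c)"

definition vcommon :: "'v \<Rightarrow> 'v \<Rightarrow> 'v set" where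
  "vcommon x y = {z. Q z = c \<and> vadj x z \<and> vadj y z}"

lemma two_c: "2 * c \<noteq> - 2 * c"
proof
  assume "2 * c = - 2 * c"
  then have "4 * c = 0" by (simp add: algebra_simps)
  then show False using four_neq_0 c_neq_0 by simp
qed

lemma minus_eq_2c: "- t = 2 * c \<longleftrightarrow> t = - (2 * c)"
  by (metis minus_minus)

lemma vadj_minus: "vadj (- x) y = vadj x y" "vadj x (- y) = vadj x y"
proof -
  have *: "y \<noteq> - x \<longleftrightarrow> - y \<noteq> x" for y x :: 'v by (metis minus_minus)
  show "vadj (- x) y = vadj x y" "vadj x (- y) = vadj x y"
    unfolding vadj_def polar_minus_left polar_minus_right
    using minus_eq_2c[of "B x y"] *[of y x] by auto
qed

lemma vadj_commute: "vadj x y = vadj y x"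
proof -
  have "y \<noteq> - x \<longleftrightarrow> x \<noteq> - y" by (metis minus_minus)
  then show ?thesis unfolding vadj_def polar_commute[of y x] by metis
qed

lemma vcommon_minus: "vcommon (- x) y = vcommon x y" "vcommon x (- y) = vcommon x y"
  by (simp_all add: vcommon_def vadj_minus)

lemma uminus_vcommon: "z \<in> vcommon x y \<Longrightarrow> - z \<in> vcommon x y"
  by (simp add: vcommon_def vadj_minus)

lemma nontangent_pairI:
  assumes "Q x = c" "Q y = c" "y \<noteq> x" "y \<noteq> - x" "\<not> vadj x y"
  shows "nontangent_pair (*s) Q n c x y"
  by unfold_locales (use assms in \<open>auto simp: vadj_def\<close>)

context
  fixes x y
  assumes xy: "Q x = c" "Q y = c" "y \<noteq> x" "y \<noteq> - x" "\<not> vadj x y"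
begin

text \<open>The inequalities in \<open>vadj\<close> hold automatically here: if \<open>z\<close>
  were, up to sign, one of \<open>x, y\<close>, then its product with the other would make that pair
  tangent.\<close>

lemma vcommon_eq:
  "vcommon x y = {z. Q z = c \<and> (B x z = 2 * c \<or> B x z = - 2 * c) \<and> (B y z = 2 * c \<or> B y z = - 2 * c)}"
proof -
  have b: "B x y \<noteq> 2 * c" "B x y \<noteq> - (2 * c)" "- B x y \<noteq> 2 * c"
    using xy(3-5) minus_eq_2c[of "B x y"] by (auto simp: vadj_def)
  have "z \<noteq> x \<and> z \<noteq> - x \<and> z \<noteq> y \<and> z \<noteq> - y"
    if "B x z = 2 * c \<or> B x z = - 2 * c" "B y z = 2 * c \<or> B y z = - 2 * c" for z
    using that b by (auto simp: polar_minus_right polar_commute[of y x])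
  then show ?thesis by (auto simp: vcommon_def vadj_def)
qed

text \<open>Of the four sign classes, negating \<open>z\<close> pairs those with opposite signs. One
  representative belongs to the pair \<open>x, y\<close> and one to \<open>x, - y\<close>, and both
  have the same size because that size is independent of \<open>B x y\<close>.\<close>

lemma card_vcommon: "CARD('k) * int (card (vcommon x y)) = 4 * (CARD('k) ^ Suc (2 * n) + E)"
proof -
  have m: "- y \<noteq> x" "y \<noteq> - x" "- y \<noteq> - x" using xy by auto
  interpret P: nontangent_pair "(*s)" Q n c x y by (rule nontangent_pairI) (use xy in auto)
  interpret M: nontangent_pair "(*s)" Q n c x "- y"
    by (rule nontangent_pairI) (use xy m in \<open>auto simp: vadj_minus\<close>)
  define d where "d = 2 * c"
  have d: "2 * c = d" "- 2 * c = - d" "d \<noteq> - d" using two_c by (simp_all add: d_def)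
  define T where "T i j = {z. Q z = c \<and> B x z = i \<and> B y z = j}" for i j
  have neg: "card (T (- i) (- j)) = card (T i j)" for i j
    by (rule bij_betw_same_card[of uminus], rule bij_betw_byWitness[of _ uminus])
      (auto simp: T_def polar_minus_right)
  have disj: "T i j \<inter> T i' j' = {}" if "i \<noteq> i' \<or> j \<noteq> j'" for i j i' j' using that by (auto simp: T_def)
  have "B (- y) z = d \<longleftrightarrow> B y z = - d" for z
    unfolding polar_minus_left using minus_eq_2c[of "B y z"] unfolding d .
  then have T: "vcommon_pos x y = T d d" "vcommon_pos x (- y) = T d (- d)"
    unfolding vcommon_pos_def T_def d by simp_all
  have "vcommon x y = (T d d \<union> T d (- d)) \<union> T (- d) d \<union> T (- d) (- d)"
    unfolding vcommon_eq T_def d by auto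
  also have "card \<dots> = card (T d d \<union> T d (- d)) + card (T (- d) d) + card (T (- d) (- d))"
    using disj d(3) by (intro card_Un3) (simp_all add: Int_Un_distrib2)
  also have "card (T d d \<union> T d (- d)) = card (T d d) + card (T d (- d))"
    by (rule card_Un_disjoint[OF _ _ disj]) (use d(3) in simp_all)
  also have "card (T (- d) d) = card (T d (- d))" using neg[of d "- d"] by simp
  also have "card (T (- d) (- d)) = card (T d d)" by (rule neg)
  finally have "CARD('k) * int (card (vcommon x y)) =
      2 * (CARD('k) * int (card (vcommon_pos x y))) + 2 * (CARD('k) * int (card (vcommon_pos x (- y))))"
    unfolding T by (simp add: algebra_simps)
  then show ?thesis unfolding P.card_vcommon_pos M.card_vcommon_pos by simp
qed

end

text \<open>The neighbours with \<open>B x w = 2 * c\<close> and their negatives contribute equally;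
  the added 2 stands for the excluded vectors \<open>z\<close> and \<open>- z\<close>.\<close>

lemma card_vadj_vcommon_pos:
  assumes xy: "Q x = c" "Q y = c" "y \<noteq> x" "y \<noteq> - x" "\<not> vadj x y" and z: "z \<in> vcommon_pos x y"
  shows "(int CARD('k))\<^sup>2 * (int (card {w \<in> vcommon x y. vadj z w}) + 2) =
    2 * (4 * (CARD('k) ^ Suc (2 * n) - E) + 3 * (CARD('k) * E))"
proof -
  interpret P: nontangent_pair "(*s)" Q n c x y by (rule nontangent_pairI) (use xy in auto)
  define d where "d = 2 * c"
  have d: "2 * c = d" "- 2 * c = - d" "d \<noteq> - d" using two_c by (simp_all add: d_def)
  have Bxz: "B x z = d" using z by (simp add: vcommon_pos_def d_def)
  define D where "D = {w. Q w = c \<and> B x w = d \<and> (B y w = d \<or> B y w = - d) \<and> (B z w = d \<or> B z w = - d) \<and> w \<noteq> z}"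
  define D' where "D' = {w. Q w = c \<and> B x w = - d \<and> (B y w = d \<or> B y w = - d) \<and> (B z w = d \<or> B z w = - d) \<and> w \<noteq> - z}"
  have neg: "- t = d \<longleftrightarrow> t = - d" for t using minus_eq_2c[of t] unfolding d .
  have DD: "card D' = card D"
    by (rule bij_betw_same_card[of uminus], rule bij_betw_byWitness[of _ uminus])
      (auto simp: D_def D'_def polar_minus_right neg)
  have "w \<noteq> - z" if "B x w = d" for w using that Bxz d(3) by (auto simp: polar_minus_right)
  moreover have "w \<noteq> z" if "B x w = - d" for w using that Bxz d(3) by auto
  ultimately have "{w \<in> vcommon x y. vadj z w} = D \<union> D'"
    unfolding vcommon_eq[OF xy] D_def D'_def vadj_def d by blast
  also have "card \<dots> = card D + card D'"
    by (rule card_Un_disjoint) (use d(3) in \<open>auto simp: D_def D'_def\<close>)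
  finally have "(int CARD('k))\<^sup>2 * (int (card {w \<in> vcommon x y. vadj z w}) + 2) =
      2 * ((int CARD('k))\<^sup>2 * (int (card D) + 1))"
    unfolding DD by (simp add: algebra_simps)
  then show ?thesis
    using P.card_vcommon_pos_adjacent[OF z, unfolded d, folded D_def] by simp
qed

text \<open>The signs of \<open>x\<close> and \<open>y\<close> can be changed so that both products
  with \<open>z\<close> are \<open>2 * c\<close>, which affects neither \<open>vadj\<close> nor
  \<open>vcommon\<close>.\<close>

lemma card_vadj_vcommon:
  assumes xy: "Q x = c" "Q y = c" "y \<noteq> x" "y \<noteq> - x" "\<not> vadj x y" and z: "z \<in> vcommon x y"
  shows "(int CARD('k))\<^sup>2 * (int (card {w \<in> vcommon x y. vadj z w}) + 2) =
    2 * (4 * (CARD('k) ^ Suc (2 * n) - E) + 3 * (CARD('k) * E))"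
proof -
  define x' where "x' = (if B x z = 2 * c then x else - x)"
  define y' where "y' = (if B y z = 2 * c then y else - y)"
  have x': "x' = x \<or> x' = - x" and y': "y' = y \<or> y' = - y" by (auto simp: x'_def y'_def)
  have "z \<in> vcommon_pos x' y'"
    using z unfolding vcommon_def vadj_def vcommon_pos_def x'_def y'_def by (auto simp: polar_minus_left)
  moreover have "vcommon x' y' = vcommon x y" using x' y' by (auto simp: vcommon_minus)
  moreover have "Q x' = c" "Q y' = c" "y' \<noteq> x'" "y' \<noteq> - x'" "\<not> vadj x' y'"
  proof -
    have "- y \<noteq> x" "- y \<noteq> - x" using xy(3,4) by auto
    then show "Q x' = c" "Q y' = c" "y' \<noteq> x'" "y' \<noteq> - x'" "\<not> vadj x' y'"
      using x' y' xy by (elim disjE; simp add: vadj_minus)+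
  qed
  ultimately show ?thesis using card_vadj_vcommon_pos[of x' y' z] by simp
qed

lemma span_eq_iff_norm:
  assumes "Q v = c" "Q w = c"
  shows "span {v} = span {w} \<longleftrightarrow> v = w \<or> v = - w"
proof
  assume "span {v} = span {w}"
  then obtain k where k: "v = k *s w" by (rule span_eq_singletonD)
  then have "k\<^sup>2 = 1" using assms c_neq_0 by (simp add: Q_scale)
  then show "v = w \<or> v = - w" using k by (auto simp: power2_eq_1_iff)
next
  assume "v = w \<or> v = - w"
  then show "span {v} = span {w}" using span_scale_singleton[of "- 1" w] by auto
qed

lemma card_points:
  assumes "\<And>v. v \<in> S \<Longrightarrow> Q v = c \<and> - v \<in> S"
  shows "card S = 2 * card ((\<lambda>v. span {v}) ` S)"
proof -
  let ?p = "\<lambda>v. span {v}"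
  have "card S = (\<Sum>p\<in>?p ` S. card {v \<in> S. ?p v = p})"
    using sum.image_gen[of S "\<lambda>_. 1::nat" ?p] by simp
  also have "\<dots> = (\<Sum>p\<in>?p ` S. 2)"
  proof (rule sum.cong[OF refl])
    fix p assume "p \<in> ?p ` S"
    then obtain w where w: "w \<in> S" "p = span {w}" by auto
    have "{v \<in> S. ?p v = p} = {w, - w}"
      using w assms span_eq_iff_norm by auto
    moreover have "w \<noteq> - w"
    proof
      assume "w = - w"
      then have "B w w = - B w w" by (metis polar_minus_right)
      then show False using two_c assms[OF w(1)] by (simp add: polar_self)
    qed
    ultimately show "card {v \<in> S. ?p v = p} = 2" by simp
  qed
  finally show ?thesis by simp
qed

lemma isometry_vadj: "isometry g \<Longrightarrow> vadj (g x) (g y) = vadj x y"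
proof -
  assume g: "isometry g"
  have "g (- x) = - g x" using isometryD(3)[OF g, of "- 1" x] by simp
  then have "g y = - g x \<longleftrightarrow> y = - x" using isometryD(1)[OF g] by (metis bij_pointE)
  moreover have "g y = g x \<longleftrightarrow> y = x" using isometryD(1)[OF g] by (metis bij_pointE)
  ultimately show ?thesis by (simp add: vadj_def isometryD(5)[OF g])
qed

text \<open>With signs of \<open>y\<close> and \<open>y'\<close> chosen to make both products
  \<open>2 * c\<close>, \<open>x\<close> is moved to \<open>x'\<close>, and a second isometry fixing
  \<open>x'\<close> moves the other vector. Undoing the sign choice leaves only equality of
  spans.\<close>

lemma isometry_transitive_vadj:
  assumes "Q x = c" "Q y = c" "vadj x y" "Q x' = c" "Q y' = c" "vadj x' y'"
  obtains g where "isometry g" "g x = x'" "span {g y} = span {y'}"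
proof -
  obtain z where z: "z = y \<or> z = - y" "B x z = 2 * c"
    using assms(3) by (auto simp: vadj_def polar_minus_right intro: that[of y] that[of "- y"])
  obtain z' where z': "z' = y' \<or> z' = - y'" "B x' z' = 2 * c"
    using assms(6) by (auto simp: vadj_def polar_minus_right intro: that[of y'] that[of "- y'"])
  have tz: "Q z = c" "x \<noteq> z" "Q z' = c" "x' \<noteq> z'"
    using assms z(1) z'(1) by (auto simp: vadj_def)
  obtain g1 where g1: "isometry g1" "g1 x = x'"
    using isometry_transitive[of x x'] assms c_neq_0 by auto
  have "B x' (g1 z) = 2 * c" using isometryD(5)[OF g1(1), of x z] g1(2) z by simp
  moreover have "x' \<noteq> g1 z" using g1 tz(2) isometryD(1)[OF g1(1)] by (metis bij_pointE)
  moreover have "Q (g1 z) = c" using isometryD(4)[OF g1(1)] tz by simp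
  ultimately obtain g2 where g2: "isometry g2" "g2 x' = x'" "g2 (g1 z) = z'"
    using isometry_transitive_tangent[OF nondegenerate_UNIV, of "g1 z" x' z'] assms z' tz c_neq_0 by auto
  let ?g = "g2 \<circ> g1"
  have g: "isometry ?g" using isometry_compose g1 g2 by blast
  have "?g (- y) = - ?g y" using isometryD(3)[OF g, of "- 1" y] by simp
  then have "?g y = z' \<or> ?g y = - z'" using g2(3) z(1) by auto
  then have "?g y = y' \<or> ?g y = - y'" using z'(1) by auto
  then have "span {?g y} = span {y'}" using span_eq_iff_norm assms isometryD(4)[OF g] by simp
  then show thesis using that[OF g] g1 g2 by simp
qed

lemma vertex_condition_4_NO:
  assumes verts: "NO_verts \<epsilon> = (\<lambda>v. span {v}) ` {v. Q v = c}"
  shows "vertex_condition 4 (NO \<epsilon>)"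
proof -
  define V where "V = pverts (NO \<epsilon>)"
  define adj where "adj p p' \<longleftrightarrow> (p, p') \<in> parcs (NO \<epsilon>)" for p p'
  have V: "V = (\<lambda>v. span {v}) ` {v. Q v = c}" by (simp add: V_def NO_def verts)
  have adj: "adj (span {x}) (span {y}) \<longleftrightarrow> vadj x y" if "Q x = c" "Q y = c" for x y
  proof -
    have "adj (span {x}) (span {y}) \<longleftrightarrow> span {x} \<noteq> span {y} \<and> tangent (span {x, y})"
      using that by (auto simp: adj_def NO_def verts span_Un_points)
    also have "\<dots> \<longleftrightarrow> vadj x y"
    proof (cases "y = x \<or> y = - x")
      case True
      then have "span {x} = span {y}" using span_eq_iff_norm[of y x] that by auto
      then show ?thesis using True by (auto simp: vadj_def)
    next
      case False
      then have "span {y} \<noteq> span {x}" using span_eq_iff_norm[of y x] that by auto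
      then show ?thesis using False tangent_iff[of x y] that c_neq_0 by (auto simp: vadj_def)
    qed
    finally show ?thesis .
  qed
  interpret NO: pair_bidirected_digraph "NO \<epsilon>" by (rule pair_bidirected_digraph_NO)
  interpret simple_graph V adj
  proof
    show "finite V" unfolding V by (rule finite_imageI) simp
    show adjV: "p \<in> V \<and> p' \<in> V" if "adj p p'" for p p'
      using that by (auto simp: V_def adj_def NO_def)
    show "adj p' p" if "adj p p'" for p p'
      using that adjV[OF that] adj vadj_commute unfolding V by blast
    show "\<not> adj p p" for p by (simp add: adj_def NO_def)
  qed
  have nbrs: "nbrs (span {x}) = (\<lambda>v. span {v}) ` {z. Q z = c \<and> vadj x z}" if "Q x = c" for x
  proof (intro equalityI subsetI)
    fix p assume "p \<in> nbrs (span {x})"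
    then have p: "adj (span {x}) p" "p \<in> V" using nbrs_subset by (auto simp: nbrs_def)
    then obtain z where "p = span {z}" "Q z = c" using V by auto
    then show "p \<in> (\<lambda>v. span {v}) ` {z. Q z = c \<and> vadj x z}" using p(1) adj that by auto
  qed (use adj that in \<open>auto simp: nbrs_def\<close>)
  have common: "nbrs (span {x}) \<inter> nbrs (span {y}) = (\<lambda>v. span {v}) ` vcommon x y"
    if xy: "Q x = c" "Q y = c" for x y
  proof (intro equalityI subsetI)
    fix p assume p: "p \<in> nbrs (span {x}) \<inter> nbrs (span {y})"
    then obtain z where z: "p = span {z}" "Q z = c" "vadj x z" using nbrs[OF xy(1)] by auto
    moreover have "vadj y z" using p z adj xy by (auto simp: nbrs_def)
    ultimately show "p \<in> (\<lambda>v. span {v}) ` vcommon x y" by (auto simp: vcommon_def)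
  qed (use nbrs xy in \<open>auto simp: vcommon_def\<close>)
  have iso_bij: "bij_betw ((`) g) V V" if g: "isometry g" for g
    unfolding bij_betw_def
  proof
    have "inj g" using isometryD(1)[OF g] by (rule bij_is_inj)
    then show "inj_on ((`) g) V" by (simp add: inj_on_def inj_image_eq_iff)
    show "(`) g ` V = V"
    proof (intro equalityI subsetI)
      fix p assume "p \<in> (`) g ` V"
      then obtain v where "p = g ` span {v}" "Q v = c" unfolding V by auto
      then show "p \<in> V" unfolding V isometry_span_singleton[OF g] using isometryD(4)[OF g] by auto
    next
      fix p assume "p \<in> V"
      then obtain v where v: "p = span {v}" "Q v = c" unfolding V by auto
      obtain u where u: "v = g u" using isometryD(1)[OF g] by (metis bij_pointE)
      then have "Q u = c" using v(2) isometryD(4)[OF g] by simp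
      moreover have "p = g ` span {u}" using u v(1) isometry_span_singleton[OF g] by simp
      ultimately show "p \<in> (`) g ` V" unfolding V by blast
    qed
  qed
  have iso_adj: "adj (g ` p) (g ` p') \<longleftrightarrow> adj p p'" if g: "isometry g" and p: "p \<in> V" "p' \<in> V" for g p p'
  proof -
    obtain v w where "p = span {v}" "Q v = c" "p' = span {w}" "Q w = c" using p unfolding V by auto
    then show ?thesis
      using adj isometryD(4)[OF g] isometry_vadj[OF g] by (simp add: isometry_span_singleton[OF g])
  qed
  have iso_counts: "card (nbrs (g ` p)) = card (nbrs p)"
    "card (nbrs (g ` p) \<inter> nbrs (g ` p')) = card (nbrs p \<inter> nbrs p')"
    "edges (nbrs (g ` p) \<inter> nbrs (g ` p')) (nbrs (g ` p) \<inter> nbrs (g ` p')) =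
      edges (nbrs p \<inter> nbrs p') (nbrs p \<inter> nbrs p')"
    if g: "isometry g" and p: "p \<in> V" "p' \<in> V" for g p p'
    by (rule automorphism_counts[OF iso_bij[OF g] iso_adj[OF g] p]; assumption)+
  have k: "card (nbrs p) = card (nbrs p')" if pV: "p \<in> V" "p' \<in> V" for p p'
  proof -
    obtain v w where vw: "p = span {v}" "Q v = c" "p' = span {w}" "Q w = c" using pV unfolding V by auto
    then obtain g where g: "isometry g" "g v = w" using isometry_transitive[of v w] c_neq_0 by auto
    then show ?thesis
      using iso_counts(1)[OF g(1) pV(1) pV(1)] vw isometry_span_singleton[OF g(1)] by simp
  qed
  \<comment> \<open>Solves \<open>card_vadj_vcommon\<close> for the number of points: each point is
    two vectors, and 2 is subtracted for the vectors of the point itself. The division is exact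
    wherever a common neighbour exists.\<close>
  define deg where "deg = nat ((2 * (4 * (CARD('k) ^ Suc (2 * n) - E) + 3 * (CARD('k) * E)) div (int CARD('k))\<^sup>2 - 2) div 2)"
  have nonadjacent: "CARD('k) * int (2 * card (nbrs p \<inter> nbrs p')) = 4 * (CARD('k) ^ Suc (2 * n) + E)"
    "edges (nbrs p \<inter> nbrs p') (nbrs p \<inter> nbrs p') = card (nbrs p \<inter> nbrs p') * deg"
    if p: "p \<in> V" "p' \<in> V" "p \<noteq> p'" "\<not> adj p p'" for p p'
  proof -
    obtain x y where px: "p = span {x}" "p' = span {y}" and Q: "Q x = c" "Q y = c" using p unfolding V by auto
    then have xy: "Q x = c" "Q y = c" "y \<noteq> x" "y \<noteq> - x" "\<not> vadj x y"
      using p(3,4) adj span_eq_iff_norm[of y x] by auto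
    let ?C = "nbrs p \<inter> nbrs p'"
    have C: "?C = (\<lambda>v. span {v}) ` vcommon x y" using common[OF Q] px by simp
    have "card (vcommon x y) = 2 * card ?C"
      unfolding C by (rule card_points) (auto simp: uminus_vcommon vcommon_def vadj_minus)
    then show "CARD('k) * int (2 * card ?C) = 4 * (CARD('k) ^ Suc (2 * n) + E)"
      using card_vcommon[OF xy] by simp
    have "card (nbrs r \<inter> ?C) = deg" if r: "r \<in> ?C" for r
    proof -
      obtain z where z: "r = span {z}" "z \<in> vcommon x y" using r C by auto
      then have Qz: "Q z = c" by (simp add: vcommon_def)
      have "nbrs r \<inter> ?C = (\<lambda>v. span {v}) ` {w \<in> vcommon x y. vadj z w}"
      proof (intro equalityI subsetI)
        fix t assume t: "t \<in> nbrs r \<inter> ?C"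
        then obtain w where w: "t = span {w}" "w \<in> vcommon x y" using C by auto
        moreover have "vadj z w" using t w z adj[OF Qz, of w] by (auto simp: nbrs_def vcommon_def)
        ultimately show "t \<in> (\<lambda>v. span {v}) ` {w \<in> vcommon x y. vadj z w}" by blast
      next
        fix t assume "t \<in> (\<lambda>v. span {v}) ` {w \<in> vcommon x y. vadj z w}"
        then show "t \<in> nbrs r \<inter> ?C" using C z adj[OF Qz] by (auto simp: nbrs_def vcommon_def)
      qed
      moreover have "card {w \<in> vcommon x y. vadj z w} = 2 * card ((\<lambda>v. span {v}) ` {w \<in> vcommon x y. vadj z w})"
        by (rule card_points) (auto simp: vcommon_def vadj_minus)
      ultimately have "(int CARD('k))\<^sup>2 * (2 * int (card (nbrs r \<inter> ?C)) + 2) =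
          2 * (4 * (CARD('k) ^ Suc (2 * n) - E) + 3 * (CARD('k) * E))"
        using card_vadj_vcommon[OF xy z(2)] by simp
      then have "2 * (4 * (CARD('k) ^ Suc (2 * n) - E) + 3 * (CARD('k) * E)) div (int CARD('k))\<^sup>2 =
          2 * int (card (nbrs r \<inter> ?C)) + 2"
        using card_field_gt_1 by (metis nonzero_mult_div_cancel_left not_one_less_zero of_nat_eq_0_iff power_eq_0_iff)
      then show ?thesis unfolding deg_def by simp
    qed
    then show "edges ?C ?C = card ?C * deg" using finite_nbrs by (simp add: edges_eq_sum)
  qed
  define pairs where "pairs = {p. fst p \<in> V \<and> snd p \<in> V \<and> fst p \<noteq> snd p}"
  have counts: "card (nbrs p \<inter> nbrs p') = card (nbrs r \<inter> nbrs r') \<and>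
      edges (nbrs p \<inter> nbrs p') (nbrs p \<inter> nbrs p') = edges (nbrs r \<inter> nbrs r') (nbrs r \<inter> nbrs r')"
    if p: "p \<in> V" "p' \<in> V" "p \<noteq> p'" and r: "r \<in> V" "r' \<in> V" "r \<noteq> r'" and eq: "adj p p' = adj r r'" for p p' r r'
  proof (cases "adj p p'")
    \<comment> \<open>Adjacent pairs are equivalent under an isometry; for nonadjacent ones the
      explicit formulas are compared.\<close>
    case True
    obtain x y where x: "p = span {x}" "p' = span {y}" "Q x = c" "Q y = c" using p unfolding V by auto
    obtain x' y' where x': "r = span {x'}" "r' = span {y'}" "Q x' = c" "Q y' = c" using r unfolding V by auto
    obtain g where g: "isometry g" "g x = x'" "span {g y} = span {y'}"
      using isometry_transitive_vadj[of x y x' y'] x x' True eq adj by auto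
    then have "g ` p = r" "g ` p' = r'" using x x' by (simp_all add: isometry_span_singleton[OF g(1)])
    then show ?thesis
      using iso_counts(2,3)[OF g(1) p(1,2)] by simp
  next
    case False
    have "int CARD('k) * int (2 * card (nbrs p \<inter> nbrs p')) = int CARD('k) * int (2 * card (nbrs r \<inter> nbrs r'))"
      using nonadjacent(1)[OF p False] nonadjacent(1)[OF r] False eq by simp
    then have "card (nbrs p \<inter> nbrs p') = card (nbrs r \<inter> nbrs r')" using card_field_gt_1 by simp
    then show ?thesis using nonadjacent(2)[OF p False] nonadjacent(2)[OF r] False eq by simp
  qed
  have pair_counts: "card (nbrs (fst p) \<inter> nbrs (snd p)) = card (nbrs (fst r) \<inter> nbrs (snd r)) \<and>
      edges (nbrs (fst p) \<inter> nbrs (snd p)) (nbrs (fst p) \<inter> nbrs (snd p)) =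
      edges (nbrs (fst r) \<inter> nbrs (snd r)) (nbrs (fst r) \<inter> nbrs (snd r))"
    if "p \<in> pairs" "r \<in> pairs" "adj (fst p) (snd p) = adj (fst r) (snd r)" for p r
    by (rule counts) (use that in \<open>simp_all add: pairs_def\<close>)
  obtain lam where lam: "\<And>p. p \<in> pairs \<Longrightarrow> card (nbrs (fst p) \<inter> nbrs (snd p)) = lam (adj (fst p) (snd p))"
    using ex_function_of_value[of pairs "\<lambda>p. adj (fst p) (snd p)" "\<lambda>p. card (nbrs (fst p) \<inter> nbrs (snd p))",
        OF pair_counts[THEN conjunct1]] by blast
  obtain ed where ed: "\<And>p. p \<in> pairs \<Longrightarrow>
      edges (nbrs (fst p) \<inter> nbrs (snd p)) (nbrs (fst p) \<inter> nbrs (snd p)) = ed (adj (fst p) (snd p))"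
    using ex_function_of_value[of pairs "\<lambda>p. adj (fst p) (snd p)"
          "\<lambda>p. edges (nbrs (fst p) \<inter> nbrs (snd p)) (nbrs (fst p) \<inter> nbrs (snd p))",
        OF pair_counts[THEN conjunct2]] by blast
  have "constant_counts_graph V adj (card (nbrs (SOME p. p \<in> V))) lam ed"
  proof unfold_locales
    show "card (nbrs p) = card (nbrs (SOME p. p \<in> V))" if "p \<in> V" for p
      using k[OF that someI[of "\<lambda>p. p \<in> V", OF that]] .
    show "card (nbrs p \<inter> nbrs p') = lam (adj p p')" if "p \<in> V" "p' \<in> V" "p \<noteq> p'" for p p'
      using lam[of "(p, p')"] that by (simp add: pairs_def)
    show "edges (nbrs p \<inter> nbrs p') (nbrs p \<inter> nbrs p') = ed (adj p p')" if "p \<in> V" "p' \<in> V" "p \<noteq> p'" for p p'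
      using ed[of "(p, p')"] that by (simp add: pairs_def)
  qed
  then show ?thesis unfolding V_def adj_def by (rule vertex_condition_4)
qed

end

theorem proposition6p3:
  fixes scale :: "'k::{field,finite} \<Rightarrow> 'v::ab_group_add \<Rightarrow> 'v"
    and Q :: "'v \<Rightarrow> 'k"
    and q m :: nat
    and \<epsilon> :: int
  assumes "primepow q" and "odd q" and "CARD('k) = q"
    and "m > 0"
    and "\<epsilon> \<in> {1, - 1}"
    and "quadratic_space scale Q"
    and "vector_space.dim scale (UNIV :: 'v set) = 2 * m + 1"
    and "quadratic_space.nondegenerate Q (UNIV :: 'v set)"
  shows "vertex_condition 4 (quadratic_space.NO scale Q \<epsilon>)"
proof -
  have "odd_quadratic_space scale Q"
  proof -
    interpret S: quadratic_space scale Q by fact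
    obtain b where b: "UNIV \<subseteq> S.span b" "card b = 2 * m + 1"
      using S.basis_exists[of UNIV] assms(7) by metis
    \<comment> \<open>The positive cardinality excludes an infinite \<open>b\<close>, whose
      \<open>card\<close> would be 0.\<close>
    then have fin: "finite b" by (intro card_ge_0_finite) simp
    have "UNIV \<subseteq> (\<lambda>u. \<Sum>v\<in>b. scale (u v) v) ` (b \<rightarrow>\<^sub>E (UNIV :: 'k set))"
    proof
      fix w
      have "w \<in> S.span b" using b(1) by blast
      then obtain u where "w = (\<Sum>v\<in>b. scale (u v) v)" unfolding S.span_finite[OF fin] by blast
      then have "w = (\<Sum>v\<in>b. scale (restrict u b v) v)" by simp
      then show "w \<in> (\<lambda>u. \<Sum>v\<in>b. scale (u v) v) ` (b \<rightarrow>\<^sub>E (UNIV :: 'k set))"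
        by (intro image_eqI[of _ _ "restrict u b"]) simp_all
    qed
    then have "finite (UNIV :: 'v set)"
      by (rule finite_subset) (intro finite_imageI finite_PiE fin finite)
    moreover have "(2::'k) \<noteq> 0" using assms(2,3) two_neq_0_of_odd_card by blast
    ultimately show ?thesis by unfold_locales
  qed
  then interpret odd_quadratic_space scale Q .
  have c: "card (UNIV :: 'v set) = CARD('k) ^ (2 * m + 1)"
    using card_subspace[OF subspace_UNIV] assms(7) by simp
  \<comment> \<open>Without vertices the condition is vacuous. Otherwise the norm of a generator of
    any vertex serves as the constant \<open>c\<close>.\<close>
  show ?thesis
  proof (cases "NO_verts \<epsilon> = {}")
    case True
    then show ?thesis by (simp add: vertex_condition_def NO_def)
  next
    case False
    then obtain x where x: "Q x \<noteq> 0" "has_type (span {x}) \<epsilon>"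
      by (auto simp: NO_verts_def nonsingular_points_eq)
    obtain n where n: "m = Suc n" using assms(4) gr0_implies_Suc by blast
    interpret odd_nondegenerate_space scale Q n "Q x"
      by unfold_locales (use assms(8) c x(1) n in simp_all)
    show ?thesis by (rule vertex_condition_4_NO[OF NO_verts_eq[OF assms(8) c x]])
  qed
qed

end
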